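(* Let $\hat\nabla$ and $\nabla$ be two $A$-anisotropic connections on $M$, with curvature tensors $\hat R$ and $R$ respectively, let $Q_v(X,Y)=\hat\nabla^v_XY-\nabla^v_XY$ be their difference tensor, and let $P$ and $\mathcal T$ be the vertical derivative and the torsion of $\nabla$. Then for every $v\in A$ and $u,w,z\in T_{\pi(v)}M$, $$\hat R_v(u,w)z=R_v(u,w)z-P_v(w,z,Q_v(u,v))+P_v(u,z,Q_v(w,v))+Q'_v(u,w)z,$$ where $$\begin{aligned}Q'_v(u,w)z={}&(\nabla_uQ)_v(w,z)-(\nabla_wQ)_v(u,z)+Q_v(\mathcal T_v(u,w),z)\\&+(\partial^\nu Q)_v(u,z,Q_v(w,v))-(\partial^\nu Q)_v(w,z,Q_v(u,v))\\&+Q_v(u,Q_v(w,z))-Q_v(w,Q_v(u,z)).\end{aligned}$$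
   Context: $M$ is a smooth manifold, $\pi:TM\to M$ its tangent bundle, $A\subset TM$ an open subset with $\pi(A)=M$, $\mathcal F(\cdot)$ denotes smooth real functions, $\mathfrak X(\cdot)$ smooth vector fields. $\mathfrak T^1_0(M,A)$ is the set of smooth maps $v\in A\mapsto\mathcal X_v\in T_{\pi(v)}M$; vector fields $X$ on $M$ are regarded as such maps via $v\mapsto X_{\pi(v)}$. An $A$-anisotropic tensor (of type $(1,s)$) is an $\mathcal F(A)$-multilinear map $T:\mathfrak T^1_0(M,A)^s\to\mathfrak T^1_0(M,A)$; it amounts to multilinear maps $T_v:(T_{\pi(v)}M)^s\to T_{\pi(v)}M$ depending smoothly on $v\in A$. Its vertical derivative is $(\partial^\nu T)_v(x_1,\ldots,x_s,z)=\frac{d}{dt}T_{v+tz}(x_1,\ldots,x_s)|_{t=0}$. A vector field $V$ on an open $\Omega\subset M$ is $A$-admissible if $V_p\in A$ for all $p\in\Omega$; it extends $v$ if $V_{\pi(v)}=v$; $(\mathcal Y_V)_p=\mathcal Y_{V_p}$. An $A$-anisotropic connection is a map $\nabla:A\times\mathfrak X(M)\times\mathfrak X(M)\to TM$, $(v,X,Y)\mapsto\nabla^v_XY\in T_{\pi(v)}M$, additive in $Y$, with $\nabla^v_X(fY)=X_{\pi(v)}(f)Y_{\pi(v)}+f(\pi(v))\nabla^v_XY$, $\nabla^v_{fX+hY}Z=f(\pi(v))\nabla^v_XZ+h(\pi(v))\nabla^v_YZ$ for $f,h\in\mathcal F(M)$, and with $\nabla_XY\in\mathfrak T^1_0(M,A)$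 (smoothness in $v$). The difference of two $A$-anisotropic connections is an $A$-anisotropic tensor. For $\mathcal Y\in\mathfrak T^1_0(M,A)$, $\nabla^v_X\mathcal Y=\nabla^v_X(\mathcal Y_V)-(\partial^\nu\mathcal Y)_v(\nabla^v_XV)$ for any local $A$-admissible extension $V$ of $v$ (independent of $V$). For an anisotropic tensor $T$ of type $(1,s)$, $(\nabla_XT)(X_1,\ldots,X_s)=\nabla_X(T(X_1,\ldots,X_s))-\sum_jT(X_1,\ldots,\nabla_XX_j,\ldots,X_s)$; $(\nabla_XT)_v$ depends only on $X_{\pi(v)}$, so $(\nabla_uT)_v$ makes sense for $u\in T_{\pi(v)}M$. Torsion: $\mathcal T_v(X,Y)=\nabla^v_XY-\nabla^v_YX-[X,Y]_{\pi(v)}$. Vertical derivative of $\nabla$: $P_v(X,Y,Z)=\frac{\partial}{\partial t}\big(\nabla^{v+tZ}_XY\big)|_{t=0}$. Curvature tensor: $R_v(X,Y)Z=\nabla^v_X(\nabla_YZ)-\nabla^v_Y(\nabla_XZ)-\nabla^v_{[X,Y]}Z$ for $X,Y,Z\in\mathfrak X(M)$. These are $A$-anisotropic tensors. *)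

theory Defs
  imports "HOL-Analysis.Analysis"
begin

section \<open>Smooth maps between Euclidean spaces\<close>

primrec continuously_differentiable_on ::
  "nat \<Rightarrow> ('e::real_normed_vector) set \<Rightarrow> ('e \<Rightarrow> 'f::real_normed_vector) \<Rightarrow> bool" where
  "continuously_differentiable_on 0 S f \<longleftrightarrow> continuous_on S f"
| "continuously_differentiable_on (Suc k) S f \<longleftrightarrow>
     (\<forall>x\<in>S. f differentiable (at x)) \<and>
     (\<forall>h. continuously_differentiable_on k S (\<lambda>x. frechet_derivative f (at x) h))"

text \<open>Only meaningful for open \<open>S\<close>, because the derivatives are two-sided.\<close>

definition smooth_on :: "('e::real_normed_vector) set \<Rightarrow> ('e \<Rightarrow> 'f::real_normed_vector) \<Rightarrow> bool" where
  "smooth_on S f \<longleftrightarrow> (\<forall>k. continuously_differentiable_on k S f)"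


section \<open>Smooth manifolds\<close>

text \<open>The underlying set of the manifold is the whole type \<open>'a\<close>, and \<open>'e\<close> is the model space.
  A chart is a pair of a domain and a coordinate map, of which only the values on the domain matter.\<close>

type_synonym ('a, 'e) chart = "'a set \<times> ('a \<Rightarrow> 'e)"

abbreviation cdom :: "('a, 'e) chart \<Rightarrow> 'a set" where "cdom \<equiv> fst"

abbreviation cmap :: "('a, 'e) chart \<Rightarrow> 'a \<Rightarrow> 'e" where "cmap \<equiv> snd"

definition cinv :: "('a, 'e) chart \<Rightarrow> 'e \<Rightarrow> 'a" where
  "cinv c = inv_into (cdom c) (cmap c)"

definition smooth_atlas ::
  "('a::{t2_space,second_countable_topology}, 'e::euclidean_space) chart set \<Rightarrow> bool" where
  "smooth_atlas \<A> \<longleftrightarrow>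
     (\<Union>c\<in>\<A>. cdom c) = UNIV \<and>
     (\<forall>c\<in>\<A>. open (cdom c) \<and> open (cmap c ` cdom c) \<and>
              homeomorphism (cdom c) (cmap c ` cdom c) (cmap c) (cinv c)) \<and>
     (\<forall>c\<in>\<A>. \<forall>d\<in>\<A>. smooth_on (cmap c ` (cdom c \<inter> cdom d)) (cmap d \<circ> cinv c))"

definition smooth_fun :: "('a, 'e::euclidean_space) chart set \<Rightarrow> ('a \<Rightarrow> real) \<Rightarrow> bool" where
  "smooth_fun \<A> f \<longleftrightarrow> (\<forall>c\<in>\<A>. smooth_on (cmap c ` cdom c) (f \<circ> cinv c))"


section \<open>Tangent vectors and vector fields\<close>

text \<open>A tangent vector is given by its coordinates in all the charts of the atlas around its base
  point, related by the derivatives of the transition maps.  The type below carries arbitrary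
  families of coordinates, with pointwise vector space operations; the tangent space at \<open>p\<close> is a
  linear subspace of it.  The coordinates in the charts that are not around \<open>p\<close> are set to \<open>0\<close>.\<close>

typedef ('a, 'e) tvec = "UNIV :: (('a, 'e) chart \<Rightarrow> 'e) set"
  morphisms coords of_coords ..

lemma coords_of_coords [simp]: "coords (of_coords g) = g"
  by (simp add: of_coords_inverse)

lemma tvec_eqI: "(\<And>c. coords x c = coords y c) \<Longrightarrow> x = y"
  by (metis coords_inject ext)

instantiation tvec :: (type, real_vector) real_vector
begin

definition "0 = of_coords (\<lambda>c. 0)"
definition "x + y = of_coords (\<lambda>c. coords x c + coords y c)"
definition "- x = of_coords (\<lambda>c. - coords x c)"
definition "x - y = of_coords (\<lambda>c. coords x c - coords y c)"
definition "r *\<^sub>R x = of_coords (\<lambda>c. r *\<^sub>R coords x c)"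

instance
  by standard
    (auto intro!: tvec_eqI simp: zero_tvec_def plus_tvec_def uminus_tvec_def minus_tvec_def
      scaleR_tvec_def algebra_simps)

end

definition tangent_space ::
  "('a, 'e::euclidean_space) chart set \<Rightarrow> 'a \<Rightarrow> ('a, 'e) tvec set" where
  "tangent_space \<A> p =
     {x. (\<forall>c. \<not> (c \<in> \<A> \<and> p \<in> cdom c) \<longrightarrow> coords x c = 0) \<and>
         (\<forall>c\<in>\<A>. \<forall>d\<in>\<A>. p \<in> cdom c \<inter> cdom d \<longrightarrow>
            coords x d = frechet_derivative (cmap d \<circ> cinv c) (at (cmap c p)) (coords x c))}"

text \<open>The derivative \<open>x(f)\<close> of a function \<open>f\<close> along \<open>x \<in> T\<^sub>pM\<close>, computed in any chart around \<open>p\<close>.\<close>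

definition deriv_along ::
  "('a, 'e::euclidean_space) chart set \<Rightarrow> 'a \<Rightarrow> ('a, 'e) tvec \<Rightarrow> ('a \<Rightarrow> real) \<Rightarrow> real" where
  "deriv_along \<A> p x f =
     (let c = (SOME c. c \<in> \<A> \<and> p \<in> cdom c)
      in frechet_derivative (f \<circ> cinv c) (at (cmap c p)) (coords x c))"

definition vfields_on ::
  "('a, 'e::euclidean_space) chart set \<Rightarrow> 'a set \<Rightarrow> ('a \<Rightarrow> ('a, 'e) tvec) set" where
  "vfields_on \<A> \<Omega> =
     {X. (\<forall>p\<in>\<Omega>. X p \<in> tangent_space \<A> p) \<and>
         (\<forall>c\<in>\<A>. smooth_on (cmap c ` (cdom c \<inter> \<Omega>)) (\<lambda>x. coords (X (cinv c x)) c))}"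

abbreviation vfields :: "('a, 'e::euclidean_space) chart set \<Rightarrow> ('a \<Rightarrow> ('a, 'e) tvec) set" where
  "vfields \<A> \<equiv> vfields_on \<A> UNIV"

text \<open>In a chart, \<open>[X, Y]\<^sup>i = X\<^sup>j \<partial>\<^sub>jY\<^sup>i - Y\<^sup>j \<partial>\<^sub>jX\<^sup>i\<close>.\<close>

definition lie_bracket ::
  "('a, 'e::euclidean_space) chart set \<Rightarrow> ('a \<Rightarrow> ('a, 'e) tvec) \<Rightarrow> ('a \<Rightarrow> ('a, 'e) tvec)
     \<Rightarrow> 'a \<Rightarrow> ('a, 'e) tvec" where
  "lie_bracket \<A> X Y p = of_coords (\<lambda>c.
     if c \<in> \<A> \<and> p \<in> cdom c
     then frechet_derivative (\<lambda>x. coords (Y (cinv c x)) c) (at (cmap c p)) (coords (X p) c)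
        - frechet_derivative (\<lambda>x. coords (X (cinv c x)) c) (at (cmap c p)) (coords (Y p) c)
     else 0)"


section \<open>The tangent bundle\<close>

text \<open>Points of \<open>TM\<close> are pairs \<open>v = (p, x)\<close> with \<open>x \<in> T\<^sub>pM\<close>, so \<open>fst\<close> is the projection \<open>\<pi>\<close>.\<close>

type_synonym ('a, 'e) tpoint = "'a \<times> ('a, 'e) tvec"

definition tangent_bundle :: "('a, 'e::euclidean_space) chart set \<Rightarrow> ('a, 'e) tpoint set" where
  "tangent_bundle \<A> = {v. snd v \<in> tangent_space \<A> (fst v)}"

text \<open>The chart of \<open>TM\<close> induced by a chart of \<open>M\<close>.\<close>

definition tdom ::
  "('a, 'e::euclidean_space) chart set \<Rightarrow> ('a, 'e) chart \<Rightarrow> ('a, 'e) tpoint set" where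
  "tdom \<A> c = {v \<in> tangent_bundle \<A>. fst v \<in> cdom c}"

definition tmap :: "('a, 'e::euclidean_space) chart \<Rightarrow> ('a, 'e) tpoint \<Rightarrow> 'e \<times> 'e" where
  "tmap c v = (cmap c (fst v), coords (snd v) c)"

definition tinv ::
  "('a, 'e::euclidean_space) chart set \<Rightarrow> ('a, 'e) chart \<Rightarrow> 'e \<times> 'e \<Rightarrow> ('a, 'e) tpoint" where
  "tinv \<A> c = inv_into (tdom \<A> c) (tmap c)"

definition open_in_tangent_bundle ::
  "('a, 'e::euclidean_space) chart set \<Rightarrow> ('a, 'e) tpoint set \<Rightarrow> bool" where
  "open_in_tangent_bundle \<A> A \<longleftrightarrow>
     A \<subseteq> tangent_bundle \<A> \<and> (\<forall>c\<in>\<A>. open (tmap c ` (A \<inter> tdom \<A> c)))"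


section \<open>Anisotropic calculus\<close>

text \<open>\<open>aniso_fields \<A> A\<close> is the module of smooth maps \<open>v \<in> A \<mapsto> \<Y>\<^sub>v \<in> T\<^bsub>\<pi>(v)\<^esub>M\<close>; only the values
  on \<open>A\<close> matter.\<close>

definition aniso_fields ::
  "('a, 'e::euclidean_space) chart set \<Rightarrow> ('a, 'e) tpoint set
     \<Rightarrow> (('a, 'e) tpoint \<Rightarrow> ('a, 'e) tvec) set" where
  "aniso_fields \<A> A =
     {\<Y>. (\<forall>v\<in>A. \<Y> v \<in> tangent_space \<A> (fst v)) \<and>
         (\<forall>c\<in>\<A>. smooth_on (tmap c ` (A \<inter> tdom \<A> c)) (\<lambda>x. coords (\<Y> (tinv \<A> c x)) c))}"

text \<open>The derivative of \<open>t \<mapsto> \<Y>\<^bsub>v + tz\<^esub> \<in> T\<^bsub>\<pi>(v)\<^esub>M\<close> at \<open>t = 0\<close>, taken coordinatewise.  For a tensor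
  \<open>T\<close> it is applied to \<open>\<lambda>v. T v x\<^sub>1 \<dots> x\<^sub>s\<close>.\<close>

definition vertical_deriv ::
  "(('a, 'e::euclidean_space) tpoint \<Rightarrow> ('a, 'e) tvec) \<Rightarrow> ('a, 'e) tpoint \<Rightarrow> ('a, 'e) tvec
     \<Rightarrow> ('a, 'e) tvec" where
  "vertical_deriv \<Y> v z = of_coords (\<lambda>c.
     vector_derivative (\<lambda>t. coords (\<Y> (fst v, snd v + t *\<^sub>R z)) c) (at 0))"

definition admissible_on ::
  "('a::topological_space, 'e::euclidean_space) chart set \<Rightarrow> ('a, 'e) tpoint set \<Rightarrow> 'a set
     \<Rightarrow> ('a \<Rightarrow> ('a, 'e) tvec) \<Rightarrow> bool" where
  "admissible_on \<A> A \<Omega> V \<longleftrightarrow> open \<Omega> \<and> V \<in> vfields_on \<A> \<Omega> \<and> (\<forall>p\<in>\<Omega>. (p, V p) \<in> A)"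

type_synonym ('a, 'e) conn =
  "('a, 'e) tpoint \<Rightarrow> ('a \<Rightarrow> ('a, 'e) tvec) \<Rightarrow> ('a \<Rightarrow> ('a, 'e) tvec) \<Rightarrow> ('a, 'e) tvec"

definition aniso_connection ::
  "('a, 'e::euclidean_space) chart set \<Rightarrow> ('a, 'e) tpoint set \<Rightarrow> ('a, 'e) conn \<Rightarrow> bool" where
  "aniso_connection \<A> A D \<longleftrightarrow>
     (\<forall>X\<in>vfields \<A>. \<forall>Y\<in>vfields \<A>. (\<lambda>v. D v X Y) \<in> aniso_fields \<A> A) \<and>
     (\<forall>v\<in>A. \<forall>X\<in>vfields \<A>. \<forall>Y\<in>vfields \<A>. \<forall>Z\<in>vfields \<A>.
        D v X (\<lambda>p. Y p + Z p) = D v X Y + D v X Z) \<and>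
     (\<forall>v\<in>A. \<forall>X\<in>vfields \<A>. \<forall>Y\<in>vfields \<A>. \<forall>f. smooth_fun \<A> f \<longrightarrow>
        D v X (\<lambda>p. f p *\<^sub>R Y p) =
          deriv_along \<A> (fst v) (X (fst v)) f *\<^sub>R Y (fst v) + f (fst v) *\<^sub>R D v X Y) \<and>
     (\<forall>v\<in>A. \<forall>X\<in>vfields \<A>. \<forall>Y\<in>vfields \<A>. \<forall>Z\<in>vfields \<A>. \<forall>f h.
        smooth_fun \<A> f \<longrightarrow> smooth_fun \<A> h \<longrightarrow>
        D v (\<lambda>p. f p *\<^sub>R X p + h p *\<^sub>R Y p) Z = f (fst v) *\<^sub>R D v X Z + h (fst v) *\<^sub>R D v Y Z)"

text \<open>\<open>\<nabla>\<^sup>v\<^sub>X W\<close> for a vector field \<open>W\<close> that is only defined near \<open>\<pi>(v)\<close>: its value on any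
  global field with the same germ at \<open>\<pi>(v)\<close>.\<close>

definition conn_local ::
  "('a::topological_space, 'e::euclidean_space) chart set \<Rightarrow> ('a, 'e) conn \<Rightarrow> ('a, 'e) conn" where
  "conn_local \<A> D v X W =
     (THE r. \<forall>W'\<in>vfields \<A>. (\<forall>\<^sub>F p in nhds (fst v). W' p = W p) \<longrightarrow> r = D v X W')"

text \<open>\<open>\<nabla>\<^sup>v\<^sub>X \<Y>\<close> for an anisotropic field \<open>\<Y>\<close>.  The value does not depend on the extension \<open>V\<close>
  of \<open>v\<close>, which is what makes the description definite.\<close>

definition conn_aniso ::
  "('a::topological_space, 'e::euclidean_space) chart set \<Rightarrow> ('a, 'e) tpoint set \<Rightarrow> ('a, 'e) conn
     \<Rightarrow> ('a, 'e) tpoint \<Rightarrow> ('a \<Rightarrow> ('a, 'e) tvec) \<Rightarrow> (('a, 'e) tpoint \<Rightarrow> ('a, 'e) tvec)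
     \<Rightarrow> ('a, 'e) tvec" where
  "conn_aniso \<A> A D v X \<Y> =
     (THE r. \<forall>\<Omega> V. admissible_on \<A> A \<Omega> V \<longrightarrow> fst v \<in> \<Omega> \<longrightarrow> V (fst v) = snd v \<longrightarrow>
        r = conn_local \<A> D v X (\<lambda>p. \<Y> (p, V p)) - vertical_deriv \<Y> v (conn_local \<A> D v X V))"

text \<open>The values on vectors of a tensor given on vector fields: \<open>B X Y\<close> for any fields \<open>X, Y\<close>
  extending the given vectors at \<open>p\<close>.\<close>

definition on_vectors2 ::
  "('a, 'e::euclidean_space) chart set \<Rightarrow> 'a
     \<Rightarrow> (('a \<Rightarrow> ('a, 'e) tvec) \<Rightarrow> ('a \<Rightarrow> ('a, 'e) tvec) \<Rightarrow> ('a, 'e) tvec)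
     \<Rightarrow> ('a, 'e) tvec \<Rightarrow> ('a, 'e) tvec \<Rightarrow> ('a, 'e) tvec" where
  "on_vectors2 \<A> p B x y =
     (THE r. \<forall>X\<in>vfields \<A>. \<forall>Y\<in>vfields \<A>. X p = x \<longrightarrow> Y p = y \<longrightarrow> r = B X Y)"

definition on_vectors3 ::
  "('a, 'e::euclidean_space) chart set \<Rightarrow> 'a
     \<Rightarrow> (('a \<Rightarrow> ('a, 'e) tvec) \<Rightarrow> ('a \<Rightarrow> ('a, 'e) tvec) \<Rightarrow> ('a \<Rightarrow> ('a, 'e) tvec) \<Rightarrow> ('a, 'e) tvec)
     \<Rightarrow> ('a, 'e) tvec \<Rightarrow> ('a, 'e) tvec \<Rightarrow> ('a, 'e) tvec \<Rightarrow> ('a, 'e) tvec" where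
  "on_vectors3 \<A> p B x y z =
     (THE r. \<forall>X\<in>vfields \<A>. \<forall>Y\<in>vfields \<A>. \<forall>Z\<in>vfields \<A>.
        X p = x \<longrightarrow> Y p = y \<longrightarrow> Z p = z \<longrightarrow> r = B X Y Z)"

text \<open>Anisotropic tensors of type \<open>(1,2)\<close> and \<open>(1,3)\<close>, as families of maps on vectors.\<close>

type_synonym ('a, 'e) tensor2 =
  "('a, 'e) tpoint \<Rightarrow> ('a, 'e) tvec \<Rightarrow> ('a, 'e) tvec \<Rightarrow> ('a, 'e) tvec"

type_synonym ('a, 'e) tensor3 =
  "('a, 'e) tpoint \<Rightarrow> ('a, 'e) tvec \<Rightarrow> ('a, 'e) tvec \<Rightarrow> ('a, 'e) tvec \<Rightarrow> ('a, 'e) tvec"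

definition difference_tensor ::
  "('a, 'e::euclidean_space) chart set \<Rightarrow> ('a, 'e) conn \<Rightarrow> ('a, 'e) conn \<Rightarrow> ('a, 'e) tensor2" where
  "difference_tensor \<A> D' D v = on_vectors2 \<A> (fst v) (\<lambda>X Y. D' v X Y - D v X Y)"

definition torsion ::
  "('a, 'e::euclidean_space) chart set \<Rightarrow> ('a, 'e) conn \<Rightarrow> ('a, 'e) tensor2" where
  "torsion \<A> D v =
     on_vectors2 \<A> (fst v) (\<lambda>X Y. D v X Y - D v Y X - lie_bracket \<A> X Y (fst v))"

definition conn_vertical_deriv ::
  "('a, 'e::euclidean_space) chart set \<Rightarrow> ('a, 'e) conn \<Rightarrow> ('a, 'e) tensor3" where
  "conn_vertical_deriv \<A> D v x y z =
     on_vectors2 \<A> (fst v) (\<lambda>X Y. vertical_deriv (\<lambda>v'. D v' X Y) v z) x y"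

text \<open>\<open>curvature \<A> A D v x y z\<close> is \<open>R\<^sub>v(x, y)z\<close>.\<close>

definition curvature ::
  "('a::topological_space, 'e::euclidean_space) chart set \<Rightarrow> ('a, 'e) tpoint set \<Rightarrow> ('a, 'e) conn
     \<Rightarrow> ('a, 'e) tensor3" where
  "curvature \<A> A D v = on_vectors3 \<A> (fst v) (\<lambda>X Y Z.
     conn_aniso \<A> A D v X (\<lambda>v'. D v' Y Z) - conn_aniso \<A> A D v Y (\<lambda>v'. D v' X Z)
     - D v (lie_bracket \<A> X Y) Z)"

definition cov_deriv_aniso ::
  "('a::topological_space, 'e::euclidean_space) chart set \<Rightarrow> ('a, 'e) tpoint set \<Rightarrow> ('a, 'e) conn
     \<Rightarrow> ('a, 'e) tensor2 \<Rightarrow> ('a, 'e) tpoint \<Rightarrow> ('a \<Rightarrow> ('a, 'e) tvec)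
     \<Rightarrow> (('a, 'e) tpoint \<Rightarrow> ('a, 'e) tvec) \<Rightarrow> (('a, 'e) tpoint \<Rightarrow> ('a, 'e) tvec)
     \<Rightarrow> ('a, 'e) tvec" where
  "cov_deriv_aniso \<A> A D T v X \<Y> \<Z> =
     conn_aniso \<A> A D v X (\<lambda>v'. T v' (\<Y> v') (\<Z> v'))
     - T v (conn_aniso \<A> A D v X \<Y>) (\<Z> v) - T v (\<Y> v) (conn_aniso \<A> A D v X \<Z>)"

text \<open>\<open>cov_deriv \<A> A D T v x y z\<close> is \<open>(\<nabla>\<^sub>xT)\<^sub>v(y, z)\<close>.  Vector fields on \<open>M\<close> are used as anisotropic
  fields through \<open>v \<mapsto> X\<^bsub>\<pi>(v)\<^esub>\<close>.\<close>

definition cov_deriv ::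
  "('a::topological_space, 'e::euclidean_space) chart set \<Rightarrow> ('a, 'e) tpoint set \<Rightarrow> ('a, 'e) conn
     \<Rightarrow> ('a, 'e) tensor2 \<Rightarrow> ('a, 'e) tensor3" where
  "cov_deriv \<A> A D T v = on_vectors3 \<A> (fst v) (\<lambda>X Y Z.
     cov_deriv_aniso \<A> A D T v X (\<lambda>v'. Y (fst v')) (\<lambda>v'. Z (fst v')))"

end

theory Submission
  imports Defs
begin

text \<open>
  In a chart an anisotropic connection is given by Christoffel symbols \<open>\<Gamma>\<close> depending on the point
  \<open>v = (x, y)\<close> of \<open>TM\<close>, and covariant differentiation of an anisotropic field becomes
  \<open>\<nabla>\<^sub>X \<Y> = d\<Y>(X, - \<Gamma>\<^sub>v(X, y)) + \<Gamma>\<^sub>v(X, \<Y>\<^sub>v)\<close>.  Hence the curvature has the coordinates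
  \<open>d(\<Gamma>(w, z))(u, - \<Gamma>\<^sub>v(u, y)) + \<Gamma>\<^sub>v(u, \<Gamma>\<^sub>v(w, z))\<close>, antisymmetrized in \<open>u\<close> and \<open>w\<close>, while \<open>P\<close> is
  the vertical derivative of \<open>\<Gamma>\<close> and \<open>\<T>\<close> its antisymmetrization.  Replacing \<open>\<Gamma>\<close> by \<open>\<Gamma> + Q\<close> and
  expanding gives the formula.  Tensoriality, which makes the descriptions in the definitions
  proper, is read off the same coordinate expressions; bump functions provide the global fields
  with prescribed germs.
\<close>

section \<open>Calculus of smooth maps\<close>

text \<open>The definitions speak through definite descriptions over global vector fields and over
  all admissible extensions, so no formula can be used before the described value is known to exist
  and to be unique. Coordinate lemmas therefore come in two halves: membership in the tangent space
  and the coordinates in one chart. Since a tangent vector is determined by one chart, the theorem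
  itself becomes an identity in the model space.

  The shape of that identity explains the terms. The horizontal lifts of \<open>u\<close> for the
  two connections differ by the vertical vector -Q_v(u, v); differentiating \<Gamma> + Q along it
  yields both the \<open>P\<close> terms and the vertical derivatives of \<open>Q\<close>. The
  antisymmetrized covariant derivative of \<open>Q\<close> contains Q(\<Gamma>(u, w), z) and its
  counterpart, which do not occur in the curvature; the torsion term removes exactly these. Symmetry
  of second derivatives enters twice: the Lie bracket has to be a vector field, and the second
  derivatives of the field extending \<open>z\<close> have to drop out of the curvature.\<close>

abbreviation FD :: "('a::real_normed_vector \<Rightarrow> 'b::real_normed_vector) \<Rightarrow> 'a \<Rightarrow> 'a \<Rightarrow> 'b"
  where "FD f x \<equiv> frechet_derivative f (at x)"

abbreviation Ck :: "nat \<Rightarrow> 'a::real_normed_vector set \<Rightarrow> ('a \<Rightarrow> 'b::real_normed_vector) \<Rightarrow> bool"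
  where "Ck \<equiv> continuously_differentiable_on"

lemma FD_works: "f differentiable at x \<Longrightarrow> (f has_derivative FD f x) (at x)"
  by (simp add: frechet_derivative_works)

lemma FD_eq: "(f has_derivative f') (at x) \<Longrightarrow> FD f x = f'"
  by (metis frechet_derivative_at)

lemma FD_linear: "f differentiable at x \<Longrightarrow> linear (FD f x)"
  using FD_works has_derivative_linear by blast

text \<open>\<open>frechet_derivative\<close> is a choice among the derivatives, so it suffices that
  \<open>f\<close> and \<open>g\<close> have the same derivatives at \<open>x\<close>. The equality
  then also covers points where neither is differentiable.\<close>

lemma FD_cong_open:
  assumes "open S" "x \<in> S" "\<And>y. y \<in> S \<Longrightarrow> f y = g y"
  shows "f differentiable at x \<longleftrightarrow> g differentiable at x" "FD f x = FD g x"
proof -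
  have "(f has_derivative f') (at x) \<longleftrightarrow> (g has_derivative f') (at x)" for f'
    using has_derivative_transform_within_open[of f f' x UNIV S g]
      has_derivative_transform_within_open[of g f' x UNIV S f] assms by auto
  then show "f differentiable at x \<longleftrightarrow> g differentiable at x" "FD f x = FD g x"
    by (simp_all add: differentiable_def frechet_derivative_def)
qed

section \<open>Closure properties of continuous differentiability of order \<open>k\<close>\<close>

lemma Ck_Suc_imp: "Ck (Suc k) S f \<Longrightarrow> Ck k S f"
proof (induction k arbitrary: f)
  case 0
  then have "f differentiable_on S"
    by (auto simp: differentiable_on_def intro: differentiable_at_withinI)
  then show ?case by (simp add: differentiable_imp_continuous_on)
next
  case (Suc k)
  then show ?case by (metis continuously_differentiable_on.simps(2))
qed

text \<open>Openness turns equality on \<open>S\<close> into equality near each point, so the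
  two-sided derivatives agree and the induction can pass to them.\<close>

lemma Ck_cong:
  assumes "open S" "\<And>x. x \<in> S \<Longrightarrow> f x = g x" "Ck k S f"
  shows "Ck k S g"
  using assms(2,3)
proof (induction k arbitrary: f g)
  case 0
  then show ?case by (simp cong: continuous_on_cong)
next
  case (Suc k)
  have c: "f differentiable at x \<longleftrightarrow> g differentiable at x" "FD f x = FD g x" if "x \<in> S" for x
    by (rule FD_cong_open[OF assms(1) that], rule Suc.prems(1), assumption)+
  from Suc.prems(2) have f: "\<forall>x\<in>S. f differentiable at x" "\<And>h. Ck k S (\<lambda>x. FD f x h)" by simp_all
  have "Ck k S (\<lambda>x. FD g x h)" for h
    by (rule Suc.IH[OF _ f(2)[of h]]) (simp only: c(2))
  moreover have "\<forall>x\<in>S. g differentiable at x" using f(1) c(1) by blast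
  ultimately show ?case by simp
qed

lemma Ck_subset: "Ck k S f \<Longrightarrow> T \<subseteq> S \<Longrightarrow> Ck k T f"
  by (induction k arbitrary: f) (auto intro: continuous_on_subset)

lemma Ck_local:
  assumes "\<And>x. x \<in> S \<Longrightarrow> \<exists>T. open T \<and> x \<in> T \<and> Ck k T f"
  shows "Ck k S f"
  using assms
proof (induction k arbitrary: f)
  case 0
  then have "isCont f x" if "x \<in> S" for x
    using that by (metis continuous_on_eq_continuous_at continuously_differentiable_on.simps(1))
  then show ?case by (simp add: continuous_at_imp_continuous_on)
next
  case (Suc k)
  have "Ck k S (\<lambda>x. FD f x h)" for h
    by (rule Suc.IH) (use Suc.prems in fastforce)
  then show ?case using Suc.prems by fastforce
qed

lemma Ck_const: "Ck k S (\<lambda>x. c)"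
  by (induction k arbitrary: c) auto

lemma Ck_bounded_linear: "bounded_linear L \<Longrightarrow> Ck k S L"
proof (induction k)
  case 0
  then show ?case by (simp add: linear_continuous_on)
next
  case (Suc k)
  have "(L has_derivative L) (at x)" for x
    using Suc.prems bounded_linear_imp_has_derivative by blast
  then have "FD L x = L" "L differentiable at x" for x
    by (auto simp: FD_eq differentiable_def)
  then show ?case by (simp add: Ck_const)
qed

lemma Ck_linear_compose:
  assumes L: "bounded_linear L" and "open S" "Ck k S f"
  shows "Ck k S (\<lambda>x. L (f x))"
  using assms(3)
proof (induction k arbitrary: f)
  case 0
  then show ?case using L bounded_linear.continuous_on by auto
next
  case (Suc k)
  have d: "((\<lambda>x. L (f x)) has_derivative (\<lambda>h. L (FD f x h))) (at x)" if "x \<in> S" for x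
    using Suc.prems that by (intro bounded_linear.has_derivative[OF L] FD_works) auto
  have "Ck k S (\<lambda>x. FD (\<lambda>x. L (f x)) x h)" for h
    by (rule Ck_cong[OF \<open>open S\<close> _ Suc.IH[of "\<lambda>x. FD f x h"]]) (use Suc.prems FD_eq[OF d] in auto)
  then show ?case using d by (auto simp: differentiable_def)
qed

lemma Ck_add:
  assumes "open S" "Ck k S f" "Ck k S g"
  shows "Ck k S (\<lambda>x. f x + g x)"
  using assms(2,3)
proof (induction k arbitrary: f g)
  case 0
  then show ?case by (simp add: continuous_on_add)
next
  case (Suc k)
  have d: "((\<lambda>x. f x + g x) has_derivative (\<lambda>h. FD f x h + FD g x h)) (at x)" if "x \<in> S" for x
    using Suc.prems that by (intro has_derivative_add FD_works) auto
  have "Ck k S (\<lambda>x. FD (\<lambda>x. f x + g x) x h)" for h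
    by (rule Ck_cong[OF \<open>open S\<close> _ Suc.IH[of "\<lambda>x. FD f x h" "\<lambda>x. FD g x h"]])
      (use Suc.prems FD_eq[OF d] in auto)
  then show ?case using d by (auto simp: differentiable_def)
qed

lemma Ck_sum:
  assumes "open S" "\<And>i. i \<in> I \<Longrightarrow> Ck k S (f i)"
  shows "Ck k S (\<lambda>x. \<Sum>i\<in>I. f i x)"
  using assms(2)
  by (induction I rule: infinite_finite_induct) (auto intro: Ck_const Ck_add[OF assms(1)])

text \<open>The product rule pairs each derivative with the other, undifferentiated factor, so the
  step also uses \<open>Ck_Suc_imp\<close>. Scalar multiples, products and inner products are all
  instances.\<close>

lemma (in bounded_bilinear) Ck_bilinear:
  assumes "open S" "Ck k S f" "Ck k S g"
  shows "Ck k S (\<lambda>x. prod (f x) (g x))"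
  using assms(2,3)
proof (induction k arbitrary: f g)
  case 0
  then show ?case by (simp add: continuous_on)
next
  case (Suc k)
  have d: "((\<lambda>x. prod (f x) (g x)) has_derivative (\<lambda>h. prod (f x) (FD g x h) + prod (FD f x h) (g x))) (at x)"
    if "x \<in> S" for x
    using Suc.prems that by (intro FDERIV FD_works) auto
  have "Ck k S (\<lambda>x. FD (\<lambda>x. prod (f x) (g x)) x h)" for h
  proof (rule Ck_cong[OF \<open>open S\<close>])
    show "Ck k S (\<lambda>x. prod (f x) (FD g x h) + prod (FD f x h) (g x))"
      using Suc.prems Ck_Suc_imp[OF Suc.prems(1)] Ck_Suc_imp[OF Suc.prems(2)]
      by (intro Ck_add[OF \<open>open S\<close>] Suc.IH) auto
  qed (simp add: FD_eq[OF d])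
  then show ?case using d by (auto simp: differentiable_def)
qed

text \<open>\<open>Ck\<close> differentiates along fixed directions only. Expanding a moving
  direction in the basis reduces it to fixed ones with scalar coefficients.\<close>

lemma linear_basis_expand:
  fixes L :: "'a::euclidean_space \<Rightarrow> 'b::real_vector"
  assumes "linear L"
  shows "L x = (\<Sum>b\<in>Basis. (x \<bullet> b) *\<^sub>R L b)"
proof -
  have "L x = L (\<Sum>b\<in>Basis. (x \<bullet> b) *\<^sub>R b)" by (simp add: euclidean_representation)
  also have "\<dots> = (\<Sum>b\<in>Basis. (x \<bullet> b) *\<^sub>R L b)"
    by (simp add: linear_sum[OF assms] linear_cmul[OF assms])
  finally show ?thesis .
qed

text \<open>In the chain rule the derivative of \<open>g\<close> is taken along
  \<open>FD f x h\<close>, which moves with \<open>x\<close>. Its basis expansion is a sum of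
  products of maps of order \<open>k\<close>, and the derivatives of \<open>g\<close> composed with
  \<open>f\<close> are covered by the induction hypothesis.\<close>

lemma Ck_compose:
  fixes g :: "'b::euclidean_space \<Rightarrow> 'c::real_normed_vector"
  assumes "open S" "open T" "Ck k S f" "Ck k T g" "f ` S \<subseteq> T"
  shows "Ck k S (\<lambda>x. g (f x))"
  using assms(3,4,5)
proof (induction k arbitrary: f g)
  case 0
  then show ?case by (auto intro: continuous_on_compose2)
next
  case (Suc k)
  have d: "((\<lambda>x. g (f x)) has_derivative (\<lambda>h. FD g (f x) (FD f x h))) (at x)" if "x \<in> S" for x
    by (rule has_derivative_compose[OF FD_works FD_works]) (use Suc.prems that in auto)
  have "Ck k S (\<lambda>x. FD (\<lambda>x. g (f x)) x h)" for h
  proof (rule Ck_cong[OF \<open>open S\<close>])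
    show "Ck k S (\<lambda>x. \<Sum>b\<in>Basis. (FD f x h \<bullet> b) *\<^sub>R FD g (f x) b)"
    proof (intro Ck_sum \<open>open S\<close> bounded_bilinear.Ck_bilinear[OF bounded_bilinear_scaleR])
      show "Ck k S (\<lambda>x. FD f x h \<bullet> b)" for b
        using Suc.prems by (intro Ck_linear_compose[OF bounded_linear_inner_left \<open>open S\<close>]) auto
      show "Ck k S (\<lambda>x. FD g (f x) b)" for b
        by (rule Suc.IH[of f "\<lambda>y. FD g y b"]) (use Suc.prems Ck_Suc_imp[OF Suc.prems(1)] in auto)
    qed
    show "(\<Sum>b\<in>Basis. (FD f x h \<bullet> b) *\<^sub>R FD g (f x) b) = FD (\<lambda>x. g (f x)) x h" if "x \<in> S" for x
      using Suc.prems that by (subst FD_eq[OF d[OF that]])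
        (subst linear_basis_expand[of "FD g (f x)" "FD f x h"], auto intro!: FD_linear)
  qed
  then show ?case using d by (auto simp: differentiable_def)
qed

text \<open>The derivative is a product of \<open>FD f\<close> with two copies of the inverse
  itself, so order \<open>k\<close> of the inverse gives order \<open>Suc k\<close>.\<close>

lemma Ck_inverse:
  fixes f :: "'a::real_normed_vector \<Rightarrow> real"
  assumes "open S" "Ck k S f" "\<And>x. x \<in> S \<Longrightarrow> f x \<noteq> 0"
  shows "Ck k S (\<lambda>x. inverse (f x))"
  using assms(2,3)
proof (induction k)
  case 0
  then show ?case by (auto intro: continuous_on_inverse)
next
  case (Suc k)
  have d: "((\<lambda>x. inverse (f x)) has_derivative (\<lambda>h. - (inverse (f x) * FD f x h * inverse (f x)))) (at x)"
    if "x \<in> S" for x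
    by (rule Deriv.has_derivative_inverse[OF _ FD_works]) (use Suc.prems that in auto)
  have i: "Ck k S (\<lambda>x. inverse (f x))"
    using Suc Ck_Suc_imp[OF Suc.prems(1)] by simp
  have "Ck k S (\<lambda>x. FD (\<lambda>x. inverse (f x)) x h)" for h
  proof (rule Ck_cong[OF \<open>open S\<close>])
    show "Ck k S (\<lambda>x. - (inverse (f x) * FD f x h * inverse (f x)))"
      using Suc.prems
      by (intro Ck_linear_compose[OF bounded_linear_minus[OF bounded_linear_ident] \<open>open S\<close>]
          bounded_bilinear.Ck_bilinear[OF bounded_bilinear_mult \<open>open S\<close>] i) auto
  qed (simp add: FD_eq[OF d])
  then show ?case using d by (auto simp: differentiable_def)
qed

section \<open>Closure properties of smooth maps\<close>

lemma smooth_onD: "smooth_on S f \<Longrightarrow> Ck k S f"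
  by (simp add: smooth_on_def)

lemma smooth_on_differentiable: "smooth_on S f \<Longrightarrow> x \<in> S \<Longrightarrow> f differentiable at x"
  by (metis smooth_onD continuously_differentiable_on.simps(2))

lemma smooth_on_FD_const: "smooth_on S f \<Longrightarrow> smooth_on S (\<lambda>x. FD f x h)"
  by (metis smooth_on_def continuously_differentiable_on.simps(2))

lemma smooth_on_cong: "open S \<Longrightarrow> (\<And>x. x \<in> S \<Longrightarrow> f x = g x) \<Longrightarrow> smooth_on S f \<Longrightarrow> smooth_on S g"
  unfolding smooth_on_def using Ck_cong by blast

lemma smooth_on_subset: "smooth_on S f \<Longrightarrow> T \<subseteq> S \<Longrightarrow> smooth_on T f"
  unfolding smooth_on_def using Ck_subset by blast

lemma smooth_on_local:
  assumes "\<And>x. x \<in> S \<Longrightarrow> \<exists>T. open T \<and> x \<in> T \<and> smooth_on T f"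
  shows "smooth_on S f"
  unfolding smooth_on_def by (metis Ck_local assms smooth_onD)

lemma smooth_on_const: "smooth_on S (\<lambda>x. c)"
  by (simp add: smooth_on_def Ck_const)

lemma smooth_on_bounded_linear: "bounded_linear L \<Longrightarrow> smooth_on S L"
  by (simp add: smooth_on_def Ck_bounded_linear)

lemma smooth_on_linear_compose:
  "bounded_linear L \<Longrightarrow> open S \<Longrightarrow> smooth_on S f \<Longrightarrow> smooth_on S (\<lambda>x. L (f x))"
  by (simp add: smooth_on_def Ck_linear_compose)

lemma smooth_on_add:
  "open S \<Longrightarrow> smooth_on S f \<Longrightarrow> smooth_on S g \<Longrightarrow> smooth_on S (\<lambda>x. f x + g x)"
  by (simp add: smooth_on_def Ck_add)

lemma smooth_on_minus:
  "open S \<Longrightarrow> smooth_on S f \<Longrightarrow> smooth_on S (\<lambda>x. - f x)"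
  by (rule smooth_on_linear_compose[OF bounded_linear_minus[OF bounded_linear_ident]])

lemma smooth_on_diff:
  "open S \<Longrightarrow> smooth_on S f \<Longrightarrow> smooth_on S g \<Longrightarrow> smooth_on S (\<lambda>x. f x - g x)"
  using smooth_on_add[OF _ _ smooth_on_minus] by fastforce

lemma smooth_on_sum:
  "open S \<Longrightarrow> (\<And>i. i \<in> I \<Longrightarrow> smooth_on S (f i)) \<Longrightarrow> smooth_on S (\<lambda>x. \<Sum>i\<in>I. f i x)"
  by (simp add: smooth_on_def Ck_sum)

lemma smooth_on_scaleR:
  "open S \<Longrightarrow> smooth_on S f \<Longrightarrow> smooth_on S g \<Longrightarrow> smooth_on S (\<lambda>x. f x *\<^sub>R g x)"
  by (simp add: smooth_on_def bounded_bilinear.Ck_bilinear[OF bounded_bilinear_scaleR])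

lemma smooth_on_inner_const:
  "open S \<Longrightarrow> smooth_on S f \<Longrightarrow> smooth_on S (\<lambda>x. f x \<bullet> b)"
  by (rule smooth_on_linear_compose[OF bounded_linear_inner_left])

lemma smooth_on_compose:
  fixes g :: "'b::euclidean_space \<Rightarrow> 'c::real_normed_vector"
  shows "open S \<Longrightarrow> open T \<Longrightarrow> smooth_on S f \<Longrightarrow> smooth_on T g \<Longrightarrow> f ` S \<subseteq> T \<Longrightarrow>
    smooth_on S (\<lambda>x. g (f x))"
  by (simp add: smooth_on_def Ck_compose)

lemma smooth_on_Pair:
  assumes "open S" "smooth_on S f" "smooth_on S g"
  shows "smooth_on S (\<lambda>x. (f x, g x))"
proof -
  have "smooth_on S (\<lambda>x. (f x, 0) + (0, g x))"
    by (intro smooth_on_add assms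
        smooth_on_linear_compose[where L = "\<lambda>x. (x, 0)"] smooth_on_linear_compose[where L = "\<lambda>x. (0, x)"]
        bounded_linear_Pair bounded_linear_ident bounded_linear_zero)
  then show ?thesis by simp
qed

section \<open>Derivatives along moving directions\<close>

lemma smooth_on_FD:
  fixes f :: "'a::euclidean_space \<Rightarrow> 'b::real_normed_vector"
  assumes "open S" "open T" "smooth_on T f" "smooth_on S a" "smooth_on S g" "a ` S \<subseteq> T"
  shows "smooth_on S (\<lambda>x. FD f (a x) (g x))"
proof (rule smooth_on_cong[OF \<open>open S\<close>])
  show "smooth_on S (\<lambda>x. \<Sum>b\<in>Basis. (g x \<bullet> b) *\<^sub>R FD f (a x) b)"
    using assms by (intro smooth_on_sum smooth_on_scaleR smooth_on_inner_const smooth_on_FD_const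
        smooth_on_compose[of S T a "\<lambda>y. FD f y _"])
  show "(\<Sum>b\<in>Basis. (g x \<bullet> b) *\<^sub>R FD f (a x) b) = FD f (a x) (g x)" if "x \<in> S" for x
    using assms that
    by (subst linear_basis_expand[of "FD f (a x)" "g x"]) (auto intro!: FD_linear smooth_on_differentiable)
qed

text \<open>A product rule for applying a varying linear map to a varying vector. The family is
  differentiated only at fixed arguments, which avoids treating it as a map into a space of
  operators.\<close>

lemma has_derivative_linear_family:
  fixes L :: "'x::real_normed_vector \<Rightarrow> 'a::euclidean_space \<Rightarrow> 'b::real_normed_vector"
  assumes S: "open S" "x \<in> S" and lin: "\<And>y. y \<in> S \<Longrightarrow> linear (L y)"
    and L: "\<And>b. ((\<lambda>y. L y b) has_derivative (\<lambda>h. L' h b)) (at x)"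
    and g: "(g has_derivative g') (at x)"
  shows "((\<lambda>y. L y (g y)) has_derivative (\<lambda>h. L' h (g x) + L x (g' h))) (at x)"
proof -
  have "((\<lambda>y. \<Sum>b\<in>Basis. (c \<bullet> b) *\<^sub>R L y b) has_derivative (\<lambda>h. \<Sum>b\<in>Basis. (c \<bullet> b) *\<^sub>R L' h b)) (at x)" for c
    by (intro has_derivative_sum has_derivative_scaleR_right L)
  then have "((\<lambda>y. L y c) has_derivative (\<lambda>h. \<Sum>b\<in>Basis. (c \<bullet> b) *\<^sub>R L' h b)) (at x)" for c
    by (rule has_derivative_transform_within_open[OF _ S])
      (metis lin linear_basis_expand)
  \<comment> \<open>The derivatives \<open>L'\<close> are assumed for each \<open>b\<close>
    separately; uniqueness of derivatives shows that they depend linearly on it.\<close>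
  then have e: "(\<lambda>h. \<Sum>b\<in>Basis. (c \<bullet> b) *\<^sub>R L' h b) = (\<lambda>h. L' h c)" for c
    using L has_derivative_unique by blast
  have "((\<lambda>y. \<Sum>b\<in>Basis. (g y \<bullet> b) *\<^sub>R L y b) has_derivative
      (\<lambda>h. \<Sum>b\<in>Basis. (g x \<bullet> b) *\<^sub>R L' h b + (g' h \<bullet> b) *\<^sub>R L x b)) (at x)"
    by (intro has_derivative_sum has_derivative_scaleR L has_derivative_inner_left g)
  then have "((\<lambda>y. L y (g y)) has_derivative
      (\<lambda>h. \<Sum>b\<in>Basis. (g x \<bullet> b) *\<^sub>R L' h b + (g' h \<bullet> b) *\<^sub>R L x b)) (at x)"
    by (rule has_derivative_transform_within_open[OF _ S])
      (metis lin linear_basis_expand)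
  moreover have "(\<lambda>h. \<Sum>b\<in>Basis. (g x \<bullet> b) *\<^sub>R L' h b + (g' h \<bullet> b) *\<^sub>R L x b)
      = (\<lambda>h. L' h (g x) + L x (g' h))"
    using fun_cong[OF e] by (simp add: sum.distrib linear_basis_expand[OF lin[OF S(2)], of "g' _"])
  ultimately show ?thesis by simp
qed

section \<open>Bump functions and symmetry of second derivatives\<close>

text \<open>The index makes the family closed under differentiation, up to linear combinations.\<close>

definition flat :: "nat \<Rightarrow> real \<Rightarrow> real" where
  "flat n t = (if t \<le> 0 then 0 else inverse t ^ n * exp (- inverse t))"

text \<open>From the right, substitute s = \<open>inverse t\<close>: the exponential beats every
  power of s.\<close>

lemma flat_tendsto_0: "(flat n \<longlongrightarrow> 0) (at 0)"
proof -
  have "((\<lambda>t::real. inverse t ^ n / exp (inverse t)) \<longlongrightarrow> 0) (at_right 0)"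
    using filterlim_compose[OF tendsto_power_div_exp_0 filterlim_inverse_at_top_right] .
  moreover have "\<forall>\<^sub>F t in at_right 0. inverse t ^ n / exp (inverse t) = flat n t"
    by (auto simp: eventually_at_right_field flat_def exp_minus divide_inverse intro!: exI[of _ 1])
  ultimately have "(flat n \<longlongrightarrow> 0) (at_right 0)"
    using tendsto_cong by force
  moreover have "\<forall>\<^sub>F t in at_left 0. flat n t = 0"
    by (auto simp: eventually_at_left_field flat_def intro!: exI[of _ "-1"])
  then have "(flat n \<longlongrightarrow> 0) (at_left 0)" by (rule tendsto_eventually)
  ultimately show ?thesis by (simp add: filterlim_at_split)
qed

lemma DERIV_flat: "(flat n has_real_derivative (- real n * flat (Suc n) t + flat (Suc (Suc n)) t)) (at t)"
proof -
  consider "t < 0" | "t = 0" | "t > 0" by linarith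
  then show ?thesis
  proof cases
    case 1
    have "((\<lambda>t. 0::real) has_real_derivative 0) (at t)" by simp
    then have "(flat n has_real_derivative 0) (at t)"
      by (rule has_field_derivative_transform_within_open[of _ _ _ "{..<0}"]) (use 1 in \<open>auto simp: flat_def\<close>)
    then show ?thesis using 1 by (simp add: flat_def)
  next
    case 2
    \<comment> \<open>Dividing by \<open>h\<close> raises the exponent by one, so the difference
      quotient at 0 is the next member of the family and its limit is already known.\<close>
    have "(\<lambda>h. (flat n (0 + h) - flat n 0) / h) = flat (Suc n)"
      by (auto simp: flat_def divide_inverse fun_eq_iff)
    then have "(flat n has_real_derivative 0) (at 0)"
      using flat_tendsto_0[of "Suc n"] by (simp only: DERIV_def)
    then show ?thesis using 2 by (simp add: flat_def)
  next
    case 3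
    have "((\<lambda>t. inverse t ^ n * exp (- inverse t)) has_real_derivative
        (- real n * flat (Suc n) t + flat (Suc (Suc n)) t)) (at t)"
      using 3 by (cases n) (auto intro!: derivative_eq_intros simp: flat_def field_simps power2_eq_square,
        metis One_nat_def power_eq_if)
    then show ?thesis
      by (rule has_field_derivative_transform_within_open[of _ _ _ "{0<..}"]) (use 3 in \<open>auto simp: flat_def\<close>)
  qed
qed

lemma Ck_flat: "Ck k UNIV (flat n)"
proof (induction k arbitrary: n)
  case 0
  then show ?case
    by (metis DERIV_flat DERIV_isCont continuous_at_imp_continuous_on continuously_differentiable_on.simps(1))
next
  case (Suc k)
  have d: "(flat n has_derivative (\<lambda>h. (- real n * flat (Suc n) x + flat (Suc (Suc n)) x) * h)) (at x)" for x
    using DERIV_flat[of n x] by (simp add: has_field_derivative_def)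
  have "Ck k UNIV (\<lambda>x. (- real n * flat (Suc n) x + flat (Suc (Suc n)) x) * h)" for h
    by (intro bounded_bilinear.Ck_bilinear[OF bounded_bilinear_mult] Ck_add Suc.IH Ck_const open_UNIV)
  then show ?case using FD_eq[OF d] d by (auto simp: differentiable_def)
qed

lemma smooth_bump:
  fixes a :: "'e::euclidean_space"
  assumes "r > 0"
  shows "\<exists>\<rho>::'e \<Rightarrow> real. smooth_on UNIV \<rho> \<and> (\<forall>x\<in>cball a r. \<rho> x = 1) \<and> (\<forall>x. x \<notin> cball a (2 * r) \<longrightarrow> \<rho> x = 0)"
proof -
  \<comment> \<open>The usual smooth step, 0 for \<open>t \<le> 0\<close> and 1 for
    \<open>t \<ge> 1\<close>. Its denominator is positive because \<open>t\<close> and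
    \<open>1 - t\<close> are never both nonpositive.\<close>
  define st where "st t = flat 0 t * inverse (flat 0 t + flat 0 (1 - t))" for t
  have nz: "flat 0 t + flat 0 (1 - t) \<noteq> 0" for t
    using exp_gt_zero[of "- inverse t"] exp_gt_zero[of "- inverse (1 - t)"]
    by (auto simp: flat_def simp del: exp_gt_zero)
  have "Ck k UNIV st" for k
    unfolding st_def
  proof (intro bounded_bilinear.Ck_bilinear[OF bounded_bilinear_mult] Ck_inverse Ck_add Ck_flat open_UNIV nz)
    have "Ck k UNIV (\<lambda>t::real. 1 + - t)"
      by (intro Ck_add Ck_const Ck_bounded_linear bounded_linear_minus bounded_linear_ident open_UNIV)
    then show "Ck k UNIV (\<lambda>x. flat 0 (1 - x))"
      using Ck_compose[OF open_UNIV open_UNIV _ Ck_flat] by fastforce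
  qed
  then have st: "smooth_on UNIV st" by (simp add: smooth_on_def)
  have st1: "st t = 1" if "t \<ge> 1" for t using that by (simp add: st_def flat_def)
  have st0: "st t = 0" if "t \<le> 0" for t using that by (simp add: st_def flat_def)
  \<comment> \<open>\<open>q\<close> is at least 1 up to distance \<open>r\<close> from
    \<open>a\<close> and at most 0 beyond distance \<open>2 * r\<close>. The squared norm is used
    because the norm itself is not smooth at the centre.\<close>
  define q where "q x = 2 + (- inverse (r\<^sup>2)) *\<^sub>R ((x + - a) \<bullet> (x + - a))" for x
  have "Ck k UNIV q" for k
    unfolding q_def
    by (intro Ck_add Ck_const bounded_bilinear.Ck_bilinear[OF bounded_bilinear_inner]
        bounded_bilinear.Ck_bilinear[OF bounded_bilinear_scaleR] Ck_bounded_linear bounded_linear_ident open_UNIV)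
  then have "smooth_on UNIV (\<lambda>x. st (q x))"
    using smooth_on_compose[OF open_UNIV open_UNIV _ st, of q] by (simp add: smooth_on_def)
  moreover have q: "q x = 2 - (dist a x)\<^sup>2 / r\<^sup>2" for x
    by (simp add: q_def dot_square_norm dist_norm norm_minus_commute divide_inverse)
  have "st (q x) = 1" if "x \<in> cball a r" for x
  proof (rule st1)
    have "(dist a x)\<^sup>2 \<le> r\<^sup>2" using that by (intro power_mono) auto
    then show "1 \<le> q x" using assms by (simp add: q)
  qed
  moreover have "st (q x) = 0" if "x \<notin> cball a (2 * r)" for x
  proof (rule st0)
    have "(2 * r)\<^sup>2 \<le> (dist a x)\<^sup>2" using that assms by (intro power_mono) auto
    then have "4 * r\<^sup>2 \<le> (dist a x)\<^sup>2" by (simp add: power_mult_distrib)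
    then have "2 * r\<^sup>2 \<le> (dist a x)\<^sup>2" using zero_le_power2[of r] by linarith
    then show "q x \<le> 0" using assms by (simp add: q le_divide_eq)
  qed
  ultimately show ?thesis by blast
qed

section \<open>Symmetry of second derivatives\<close>

abbreviation D2 :: "('a::real_normed_vector \<Rightarrow> 'b::real_normed_vector) \<Rightarrow> 'a \<Rightarrow> 'a \<Rightarrow> 'a \<Rightarrow> 'b"
  where "D2 f x h k \<equiv> FD (\<lambda>y. FD f y k) x h"

text \<open>The mean value theorem is applied twice: in the direction \<open>h\<close> to the
  difference along \<open>k\<close>, then in the direction \<open>k\<close> to the derivative along
  \<open>h\<close>. The left side is symmetric in \<open>h\<close> and \<open>k\<close>, the right
  side is not visibly so.\<close>

lemma second_difference_mean_value:
  fixes f :: "'a::real_normed_vector \<Rightarrow> real"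
  assumes S: "cball x r \<subseteq> S" and f: "smooth_on S f" and t: "t > 0" "t * (norm h + norm k) \<le> r"
  shows "\<exists>y\<in>cball x (t * (norm h + norm k)).
    f (x + t *\<^sub>R h + t *\<^sub>R k) - f (x + t *\<^sub>R h) - f (x + t *\<^sub>R k) + f x = t * (t * D2 f y k h)"
proof -
  have in_ball: "x + s *\<^sub>R h + u *\<^sub>R k \<in> cball x (t * (norm h + norm k))"
    if "0 \<le> s" "s \<le> t" "0 \<le> u" "u \<le> t" for s u
  proof -
    have "norm (s *\<^sub>R h + u *\<^sub>R k) \<le> s * norm h + u * norm k"
      using norm_triangle_ineq[of "s *\<^sub>R h" "u *\<^sub>R k"] that by simp
    also have "\<dots> \<le> t * norm h + t * norm k"
      using that by (intro add_mono mult_right_mono) auto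
    finally show ?thesis
      using norm_minus_cancel[of "s *\<^sub>R h + u *\<^sub>R k"] by (simp add: dist_norm algebra_simps)
  qed
  then have in_S: "x + s *\<^sub>R h + u *\<^sub>R k \<in> S"
    if "0 \<le> s" "s \<le> t" "0 \<le> u" "u \<le> t" for s u
    using that S t(2) by (meson cball_subset_cball_iff order_trans subsetD subset_cball)
  have d: "((\<lambda>s. f (x + s *\<^sub>R h + u *\<^sub>R k)) has_real_derivative FD f (x + s *\<^sub>R h + u *\<^sub>R k) h) (at s)"
    if "0 \<le> s" "s \<le> t" "0 \<le> u" "u \<le> t" for s u
  proof -
    have "f differentiable at (x + s *\<^sub>R h + u *\<^sub>R k)"
      using smooth_on_differentiable[OF f in_S[OF that]] .
    then have "((\<lambda>s. f (x + s *\<^sub>R h + u *\<^sub>R k)) has_derivative (\<lambda>e. FD f (x + s *\<^sub>R h + u *\<^sub>R k) (e *\<^sub>R h))) (at s)"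
      by (intro has_derivative_compose[OF _ FD_works]) (auto intro!: derivative_eq_intros)
    then show ?thesis
      using linear_cmul[OF FD_linear[OF \<open>f differentiable at (x + s *\<^sub>R h + u *\<^sub>R k)\<close>]]
      by (simp add: has_field_derivative_def mult_commute_abs)
  qed
  have d2: "((\<lambda>u. FD f (x + s *\<^sub>R h + u *\<^sub>R k) h) has_real_derivative D2 f (x + s *\<^sub>R h + u *\<^sub>R k) k h) (at u)"
    if "0 \<le> s" "s \<le> t" "0 \<le> u" "u \<le> t" for s u
  proof -
    have "(\<lambda>y. FD f y h) differentiable at (x + s *\<^sub>R h + u *\<^sub>R k)"
      using smooth_on_differentiable[OF smooth_on_FD_const[OF f] in_S[OF that]] .
    then have "((\<lambda>u. FD f (x + s *\<^sub>R h + u *\<^sub>R k) h) has_derivative (\<lambda>e. D2 f (x + s *\<^sub>R h + u *\<^sub>R k) (e *\<^sub>R k) h)) (at u)"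
      by (intro has_derivative_compose[OF _ FD_works, of _ _ _ _ "\<lambda>y. FD f y h"]) (auto intro!: derivative_eq_intros)
    then show ?thesis
      using linear_cmul[OF FD_linear[OF \<open>(\<lambda>y. FD f y h) differentiable at (x + s *\<^sub>R h + u *\<^sub>R k)\<close>]]
      by (simp add: has_field_derivative_def mult_commute_abs)
  qed
  \<comment> \<open>Writing the corners with \<open>0 *\<^sub>R h\<close> and
    \<open>0 *\<^sub>R k\<close> puts them into the form in which \<open>d\<close> and
    \<open>MVT2\<close> apply.\<close>
  have "\<exists>s>0. s < t \<and>
    (f (x + t *\<^sub>R h + t *\<^sub>R k) - f (x + t *\<^sub>R h + 0 *\<^sub>R k)) - (f (x + 0 *\<^sub>R h + t *\<^sub>R k) - f (x + 0 *\<^sub>R h + 0 *\<^sub>R k))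
      = (t - 0) * (FD f (x + s *\<^sub>R h + t *\<^sub>R k) h - FD f (x + s *\<^sub>R h + 0 *\<^sub>R k) h)"
    using t by (intro MVT2[where f = "\<lambda>s. f (x + s *\<^sub>R h + t *\<^sub>R k) - f (x + s *\<^sub>R h + 0 *\<^sub>R k)"] DERIV_diff d) auto
  then obtain s where s: "0 < s" "s < t"
    "(f (x + t *\<^sub>R h + t *\<^sub>R k) - f (x + t *\<^sub>R h)) - (f (x + t *\<^sub>R k) - f x)
      = t * (FD f (x + s *\<^sub>R h + t *\<^sub>R k) h - FD f (x + s *\<^sub>R h + 0 *\<^sub>R k) h)" by auto
  have "\<exists>u>0. u < t \<and> FD f (x + s *\<^sub>R h + t *\<^sub>R k) h - FD f (x + s *\<^sub>R h + 0 *\<^sub>R k) h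
      = (t - 0) * D2 f (x + s *\<^sub>R h + u *\<^sub>R k) k h"
    using t s by (intro MVT2 d2) auto
  then obtain u where u: "0 < u" "u < t" "FD f (x + s *\<^sub>R h + t *\<^sub>R k) h - FD f (x + s *\<^sub>R h + 0 *\<^sub>R k) h
      = t * D2 f (x + s *\<^sub>R h + u *\<^sub>R k) k h" by auto
  show ?thesis
    by (rule bexI[of _ "x + s *\<^sub>R h + u *\<^sub>R k"]) (use s u in_ball[of s u] in auto)
qed

text \<open>Exchanging \<open>h\<close> and \<open>k\<close> leaves the second difference unchanged,
  so the two mixed derivatives agree at intermediate points arbitrarily close to \<open>x\<close>.
  Continuity of the second derivatives, a consequence of their differentiability, carries the
  equality to \<open>x\<close>.\<close>

lemma D2_symmetric_real:
  fixes f :: "'a::real_normed_vector \<Rightarrow> real"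
  assumes "open S" "x \<in> S" and f: "smooth_on S f"
  shows "D2 f x h k = D2 f x k h"
proof (rule ccontr)
  \<comment> \<open>Half the gap between the two values: no number is strictly within
    \<open>e\<close> of both.\<close>
  define e where "e = \<bar>D2 f x h k - D2 f x k h\<bar> / 2"
  \<comment> \<open>The summand 1 keeps \<open>N\<close> positive when \<open>h\<close> and
    \<open>k\<close> vanish; the step size \<open>t\<close> divides by it.\<close>
  define N where "N = norm h + norm k + 1"
  assume "D2 f x h k \<noteq> D2 f x k h"
  then have e: "e > 0" by (simp add: e_def)
  have N: "N > 0" using norm_ge_zero[of h] norm_ge_zero[of k] unfolding N_def by linarith
  have "isCont (\<lambda>y. D2 f y a b) x" for a b
    using smooth_on_differentiable[OF smooth_on_FD_const[OF smooth_on_FD_const[OF f]] assms(2)]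
      differentiable_imp_continuous_within by blast
  then have "\<exists>d>0. \<forall>y. dist y x < d \<longrightarrow> dist (D2 f y a b) (D2 f x a b) < e" for a b
    using e unfolding continuous_at_eps_delta by blast
  then obtain d1 d2 where d: "d1 > 0" "d2 > 0"
    "\<And>y. dist y x < d1 \<Longrightarrow> dist (D2 f y h k) (D2 f x h k) < e"
    "\<And>y. dist y x < d2 \<Longrightarrow> dist (D2 f y k h) (D2 f x k h) < e"
    by meson
  obtain r where r: "r > 0" "cball x r \<subseteq> S" using assms open_contains_cball by blast
  define m where "m = min r (min d1 d2)"
  define t where "t = m / (2 * N)"
  have m: "m > 0" "m \<le> r" "m \<le> d1" "m \<le> d2" using r d by (auto simp: m_def)
  have t: "t > 0" using m N by (simp add: t_def)
  have "t * (norm h + norm k) \<le> t * N" using t by (simp add: N_def)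
  also have "\<dots> < m" using m N by (simp add: t_def)
  finally have tm: "t * (norm h + norm k) < m" .
  from tm m have tr: "t * (norm h + norm k) \<le> r" "t * (norm k + norm h) \<le> r"
    by (simp_all add: add.commute)
  obtain y where y: "y \<in> cball x (t * (norm h + norm k))"
    "f (x + t *\<^sub>R h + t *\<^sub>R k) - f (x + t *\<^sub>R h) - f (x + t *\<^sub>R k) + f x = t * (t * D2 f y k h)"
    using second_difference_mean_value[OF r(2) f t tr(1)] by blast
  obtain z where z: "z \<in> cball x (t * (norm k + norm h))"
    "f (x + t *\<^sub>R k + t *\<^sub>R h) - f (x + t *\<^sub>R k) - f (x + t *\<^sub>R h) + f x = t * (t * D2 f z h k)"
    using second_difference_mean_value[OF r(2) f t tr(2)] by blast
  have "t * (t * D2 f y k h) = t * (t * D2 f z h k)"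
    unfolding y(2)[symmetric] z(2)[symmetric] by (simp add: algebra_simps)
  then have "D2 f y k h = D2 f z h k" using t by simp
  moreover have "dist (D2 f z h k) (D2 f x h k) < e" "dist (D2 f y k h) (D2 f x k h) < e"
    using y(1) z(1) tm m by (auto intro!: d(3,4) simp: dist_commute[of _ x] add.commute)
  ultimately show False unfolding e_def dist_real_def by (smt (verit) field_sum_of_halves)
qed

text \<open>The mean value theorem needs real values, so the symmetry is transferred
  componentwise.\<close>

lemma D2_symmetric:
  fixes f :: "'a::real_normed_vector \<Rightarrow> 'b::euclidean_space"
  assumes "open S" "x \<in> S" and f: "smooth_on S f"
  shows "D2 f x h k = D2 f x k h"
proof (rule euclidean_eqI)
  fix b :: 'b
  have FDi: "FD (\<lambda>y. g y \<bullet> b) y a = FD g y a \<bullet> b" if "smooth_on S g" "y \<in> S" for g :: "'a \<Rightarrow> 'b" and y a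
    using FD_eq[OF has_derivative_inner_left[OF FD_works[OF smooth_on_differentiable[OF that]]], of b] by simp
  have "D2 f x a c \<bullet> b = D2 (\<lambda>y. f y \<bullet> b) x a c" for a c
  proof -
    have "FD (\<lambda>y. FD (\<lambda>y. f y \<bullet> b) y c) x = FD (\<lambda>y. FD f y c \<bullet> b) x"
      by (rule FD_cong_open(2)[OF assms(1,2)]) (simp add: FDi f)
    then show ?thesis using FDi[OF smooth_on_FD_const[OF f] assms(2)] by simp
  qed
  then show "D2 f x h k \<bullet> b = D2 f x k h \<bullet> b"
    using D2_symmetric_real[OF assms(1,2) smooth_on_inner_const[OF assms(1) f]] by simp
qed

lemma has_derivative_FD:
  fixes f :: "'a::euclidean_space \<Rightarrow> 'b::real_normed_vector"
  assumes "open S" "x \<in> S" "smooth_on S f" "(g has_derivative g') (at x)"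
  shows "((\<lambda>y. FD f y (g y)) has_derivative (\<lambda>h. D2 f x h (g x) + FD f x (g' h))) (at x)"
proof (rule has_derivative_linear_family[OF assms(1,2) _ _ assms(4)])
  show "linear (FD f y)" if "y \<in> S" for y
    using assms that smooth_on_differentiable by (blast intro: FD_linear)
  show "((\<lambda>y. FD f y b) has_derivative (\<lambda>h. D2 f x h b)) (at x)" for b
    using FD_works[OF smooth_on_differentiable[OF smooth_on_FD_const[OF assms(3)] assms(2)]] .
qed

section \<open>Tangent vectors and vector fields in charts\<close>

lemma coords_zero [simp]: "coords 0 c = 0"
  and coords_add [simp]: "coords (x + y) c = coords x c + coords y c"
  and coords_uminus [simp]: "coords (- x) c = - coords x c"
  and coords_diff [simp]: "coords (x - y) c = coords x c - coords y c"
  and coords_scaleR [simp]: "coords (r *\<^sub>R x) c = r *\<^sub>R coords x c"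
  by (simp_all add: zero_tvec_def plus_tvec_def uminus_tvec_def minus_tvec_def scaleR_tvec_def)

lemma coords_sum [simp]: "coords (sum f I) c = (\<Sum>i\<in>I. coords (f i) c)"
  by (induction I rule: infinite_finite_induct) auto

abbreviation field_coords :: "('a, 'e) chart \<Rightarrow> ('a \<Rightarrow> ('a, 'e) tvec) \<Rightarrow> 'e \<Rightarrow> 'e"
  where "field_coords c X \<equiv> \<lambda>x. coords (X (cinv c x)) c"

locale smooth_manifold =
  fixes \<A> :: "('a::{t2_space,second_countable_topology}, 'e::euclidean_space) chart set"
  assumes atlas: "smooth_atlas \<A>"
begin

abbreviation T :: "'a \<Rightarrow> ('a, 'e) tvec set" where "T \<equiv> tangent_space \<A>"

lemma chart_cover: obtains c where "c \<in> \<A>" "p \<in> cdom c"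
  using atlas unfolding smooth_atlas_def by blast

lemma
  assumes "c \<in> \<A>"
  shows open_cdom: "open (cdom c)"
    and open_image: "open (cmap c ` cdom c)"
    and chart_homeomorphism: "homeomorphism (cdom c) (cmap c ` cdom c) (cmap c) (cinv c)"
  using atlas assms unfolding smooth_atlas_def by blast+

lemma cinv_cmap: "c \<in> \<A> \<Longrightarrow> p \<in> cdom c \<Longrightarrow> cinv c (cmap c p) = p"
  using chart_homeomorphism by (simp add: homeomorphism_def)

lemma open_chart_image:
  assumes "c \<in> \<A>" "open N"
  shows "open (cmap c ` (cdom c \<inter> N))"
proof -
  have "openin (top_of_set (cdom c)) (cdom c \<inter> N)" using assms(2) by (simp add: openin_open_Int)
  then show ?thesis
    using homeomorphism_imp_open_map[OF chart_homeomorphism[OF assms(1)]] open_image[OF assms(1)]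
      openin_open_trans by blast
qed

lemma smooth_transition:
  "c \<in> \<A> \<Longrightarrow> d \<in> \<A> \<Longrightarrow> smooth_on (cmap c ` (cdom c \<inter> cdom d)) (cmap d \<circ> cinv c)"
  using atlas unfolding smooth_atlas_def by blast

lemma transition_differentiable:
  "c \<in> \<A> \<Longrightarrow> d \<in> \<A> \<Longrightarrow> p \<in> cdom c \<Longrightarrow> p \<in> cdom d \<Longrightarrow> (cmap d \<circ> cinv c) differentiable at (cmap c p)"
  by (rule smooth_on_differentiable[OF smooth_transition]) auto

text \<open>The chain rule for the transition map. The values of \<open>f\<close> may lie in any
  normed space, so it serves for coordinate maps, real functions and components of vector fields
  alike.\<close>

lemma chart_change:
  assumes cd: "c \<in> \<A>" "d \<in> \<A>" and p: "p \<in> cdom c" "p \<in> cdom d"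
    and f: "(f \<circ> cinv d) differentiable at (cmap d p)"
  shows "((f \<circ> cinv c) has_derivative
      (\<lambda>h. FD (f \<circ> cinv d) (cmap d p) (FD (cmap d \<circ> cinv c) (cmap c p) h))) (at (cmap c p))"
proof -
  have e: "(cmap d \<circ> cinv c) (cmap c p) = cmap d p" using cinv_cmap[OF cd(1) p(1)] by simp
  have "((\<lambda>x. (f \<circ> cinv d) ((cmap d \<circ> cinv c) x)) has_derivative
      (\<lambda>h. FD (f \<circ> cinv d) (cmap d p) (FD (cmap d \<circ> cinv c) (cmap c p) h))) (at (cmap c p))"
    using has_derivative_compose[OF FD_works FD_works, of "cmap d \<circ> cinv c" "cmap c p" "f \<circ> cinv d"] f
      transition_differentiable[OF cd p] unfolding e by blast
  then show ?thesis
    by (rule has_derivative_transform_within_open[OF _ open_chart_image[OF cd(1) open_cdom[OF cd(2)]]])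
      (use cd p in \<open>auto simp: cinv_cmap\<close>)
qed

text \<open>The case of \<open>chart_change\<close> where \<open>f\<close> is the third coordinate
  map. It makes coordinates transported from one chart consistent among all the others.\<close>

lemma transition_cocycle:
  assumes "c \<in> \<A>" "d \<in> \<A>" "e \<in> \<A>" "p \<in> cdom c" "p \<in> cdom d" "p \<in> cdom e"
  shows "FD (cmap e \<circ> cinv c) (cmap c p) h
    = FD (cmap e \<circ> cinv d) (cmap d p) (FD (cmap d \<circ> cinv c) (cmap c p) h)"
  using FD_eq[OF chart_change[OF assms(1,2,4,5) transition_differentiable[OF assms(2,3,5,6)]]] by simp

lemma transition_self:
  assumes "c \<in> \<A>" "p \<in> cdom c"
  shows "FD (cmap c \<circ> cinv c) (cmap c p) h = h"
proof -
  have "((cmap c \<circ> cinv c) has_derivative (\<lambda>h. h)) (at (cmap c p))"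
    by (rule has_derivative_transform_within_open[OF has_derivative_ident open_image[OF assms(1)]])
      (use assms in \<open>auto simp: cinv_cmap\<close>)
  then show ?thesis using FD_eq by metis
qed

lemma transition_linear:
  "c \<in> \<A> \<Longrightarrow> d \<in> \<A> \<Longrightarrow> p \<in> cdom c \<Longrightarrow> p \<in> cdom d \<Longrightarrow> linear (FD (cmap d \<circ> cinv c) (cmap c p))"
  by (intro FD_linear transition_differentiable)

lemma tangent_coords:
  "x \<in> T p \<Longrightarrow> c \<in> \<A> \<Longrightarrow> d \<in> \<A> \<Longrightarrow> p \<in> cdom c \<Longrightarrow> p \<in> cdom d \<Longrightarrow>
    coords x d = FD (cmap d \<circ> cinv c) (cmap c p) (coords x c)"
  unfolding tangent_space_def by blast

lemma tangent_coords_outside: "x \<in> T p \<Longrightarrow> \<not> (c \<in> \<A> \<and> p \<in> cdom c) \<Longrightarrow> coords x c = 0"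
  unfolding tangent_space_def by blast

lemma tangentI:
  assumes "\<And>d. \<not> (d \<in> \<A> \<and> p \<in> cdom d) \<Longrightarrow> coords x d = 0"
    and "\<And>c d. c \<in> \<A> \<Longrightarrow> d \<in> \<A> \<Longrightarrow> p \<in> cdom c \<Longrightarrow> p \<in> cdom d \<Longrightarrow>
      coords x d = FD (cmap d \<circ> cinv c) (cmap c p) (coords x c)"
  shows "x \<in> T p"
  using assms unfolding tangent_space_def by blast

text \<open>Coordinates in the other charts around \<open>p\<close> follow through the transition
  derivatives, and in the remaining charts they are 0 by convention. Identities of tangent vectors
  are thereby reduced to a single chart.\<close>

lemma tangent_eqI:
  assumes "x \<in> T p" "y \<in> T p" "c \<in> \<A>" "p \<in> cdom c" "coords x c = coords y c"
  shows "x = y"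
proof (rule tvec_eqI)
  fix d
  show "coords x d = coords y d"
    by (cases "d \<in> \<A> \<and> p \<in> cdom d") (use assms tangent_coords tangent_coords_outside in metis)+
qed

lemma subspace_tangent: "subspace (T p)"
proof (rule subspaceI)
  show "0 \<in> T p" by (rule tangentI) (simp_all add: linear_0 transition_linear)
next
  fix x y assume x: "x \<in> T p" and y: "y \<in> T p"
  show "x + y \<in> T p"
  proof (rule tangentI)
    show "coords (x + y) d = 0" if "\<not> (d \<in> \<A> \<and> p \<in> cdom d)" for d
      by (simp add: tangent_coords_outside[OF x that] tangent_coords_outside[OF y that])
    show "coords (x + y) d = FD (cmap d \<circ> cinv c) (cmap c p) (coords (x + y) c)"
      if "c \<in> \<A>" "d \<in> \<A>" "p \<in> cdom c" "p \<in> cdom d" for c d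
      by (simp add: tangent_coords[OF x that] tangent_coords[OF y that] linear_add[OF transition_linear[OF that]])
  qed
next
  fix r x assume x: "x \<in> T p"
  show "r *\<^sub>R x \<in> T p"
  proof (rule tangentI)
    show "coords (r *\<^sub>R x) d = 0" if "\<not> (d \<in> \<A> \<and> p \<in> cdom d)" for d
      by (simp add: tangent_coords_outside[OF x that])
    show "coords (r *\<^sub>R x) d = FD (cmap d \<circ> cinv c) (cmap c p) (coords (r *\<^sub>R x) c)"
      if "c \<in> \<A>" "d \<in> \<A>" "p \<in> cdom c" "p \<in> cdom d" for c d
      by (simp add: tangent_coords[OF x that] linear_cmul[OF transition_linear[OF that]])
  qed
qed

text \<open>The inverse of the coordinate isomorphism between the tangent space at \<open>p\<close>
  and the model space.\<close>

definition tvec_of :: "('a, 'e) chart \<Rightarrow> 'a \<Rightarrow> 'e \<Rightarrow> ('a, 'e) tvec" where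
  "tvec_of c p a = of_coords (\<lambda>d. if d \<in> \<A> \<and> p \<in> cdom d then FD (cmap d \<circ> cinv c) (cmap c p) a else 0)"

lemma tvec_of_tangent: "c \<in> \<A> \<Longrightarrow> p \<in> cdom c \<Longrightarrow> tvec_of c p a \<in> T p"
  by (rule tangentI) (auto simp: tvec_of_def intro!: transition_cocycle)

lemma coords_tvec_of: "c \<in> \<A> \<Longrightarrow> p \<in> cdom c \<Longrightarrow> coords (tvec_of c p a) c = a"
  by (simp add: tvec_of_def transition_self)

text \<open>Smoothness is required in every chart of the atlas, but near each point one chart
  suffices: components in another chart arise by applying the derivative of a smooth transition map,
  a case of \<open>smooth_on_FD\<close>.\<close>

lemma vfields_onI_local:
  assumes X: "\<And>q. q \<in> \<Omega> \<Longrightarrow> X q \<in> T q"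
    and loc: "\<And>q. q \<in> \<Omega> \<Longrightarrow> \<exists>c\<in>\<A>. \<exists>N. open N \<and> q \<in> N \<and> N \<subseteq> cdom c \<inter> \<Omega> \<and> smooth_on (cmap c ` N) (field_coords c X)"
  shows "X \<in> vfields_on \<A> \<Omega>"
  unfolding vfields_on_def
proof (safe)
  show "X p \<in> T p" if "p \<in> \<Omega>" for p using X[OF that] .
  fix d assume d: "d \<in> \<A>"
  show "smooth_on (cmap d ` (cdom d \<inter> \<Omega>)) (field_coords d X)"
  proof (rule smooth_on_local)
    fix x assume "x \<in> cmap d ` (cdom d \<inter> \<Omega>)"
    then obtain q where q: "x = cmap d q" "q \<in> cdom d" "q \<in> \<Omega>" by blast
    obtain c N where c: "c \<in> \<A>" and N: "open N" "q \<in> N" "N \<subseteq> cdom c \<inter> \<Omega>"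
      "smooth_on (cmap c ` N) (field_coords c X)" using loc[OF q(3)] by blast
    let ?S = "cmap d ` (cdom d \<inter> N)" and ?t = "cmap c \<circ> cinv d"
    have oS: "open ?S" using open_chart_image[OF d N(1)] .
    have oN: "open (cmap c ` N)" using open_chart_image[OF c N(1)] N(3) by (metis Int_absorb1 le_inf_iff)
    have t: "smooth_on ?S ?t"
      by (rule smooth_on_subset[OF smooth_transition[OF d c]]) (use N in blast)
    have "smooth_on ?S (\<lambda>y. FD (cmap d \<circ> cinv c) (?t y) (field_coords c X (?t y)))"
    proof (rule smooth_on_FD[OF oS open_chart_image[OF c open_cdom[OF d]] smooth_transition[OF c d] t])
      show "smooth_on ?S (\<lambda>y. field_coords c X (?t y))"
        by (rule smooth_on_compose[OF oS oN t N(4)]) (use N d in \<open>auto simp: cinv_cmap\<close>)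
    qed (use N d in \<open>auto simp: cinv_cmap\<close>)
    then have "smooth_on ?S (field_coords d X)"
    proof (rule smooth_on_cong[OF oS, rotated])
      fix y assume "y \<in> ?S"
      then obtain r where r: "y = cmap d r" "r \<in> cdom d" "r \<in> N" by blast
      then have "r \<in> cdom c" "r \<in> \<Omega>" using N by auto
      then show "FD (cmap d \<circ> cinv c) (?t y) (field_coords c X (?t y)) = field_coords d X y"
        using r c d tangent_coords[OF X c d] by (simp add: cinv_cmap)
    qed
    then show "\<exists>S. open S \<and> x \<in> S \<and> smooth_on S (field_coords d X)" using oS q N by blast
  qed
qed

lemma smooth_funI_local:
  assumes loc: "\<And>q. \<exists>c\<in>\<A>. \<exists>N. open N \<and> q \<in> N \<and> N \<subseteq> cdom c \<and> smooth_on (cmap c ` N) (f \<circ> cinv c)"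
  shows "smooth_fun \<A> f"
  unfolding smooth_fun_def
proof
  fix d assume d: "d \<in> \<A>"
  show "smooth_on (cmap d ` cdom d) (f \<circ> cinv d)"
  proof (rule smooth_on_local)
    fix x assume "x \<in> cmap d ` cdom d"
    then obtain q where q: "x = cmap d q" "q \<in> cdom d" by blast
    obtain c N where c: "c \<in> \<A>" and N: "open N" "q \<in> N" "N \<subseteq> cdom c"
      "smooth_on (cmap c ` N) (f \<circ> cinv c)" using loc[of q] by blast
    let ?S = "cmap d ` (cdom d \<inter> N)" and ?t = "cmap c \<circ> cinv d"
    have oS: "open ?S" using open_chart_image[OF d N(1)] .
    have oN: "open (cmap c ` N)" using open_chart_image[OF c N(1)] N(3) by (metis Int_absorb1)
    have t: "smooth_on ?S ?t"
      by (rule smooth_on_subset[OF smooth_transition[OF d c]]) (use N in blast)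
    have "smooth_on ?S (\<lambda>y. (f \<circ> cinv c) (?t y))"
      by (rule smooth_on_compose[OF oS oN t N(4)]) (use N d in \<open>auto simp: cinv_cmap\<close>)
    then have "smooth_on ?S (f \<circ> cinv d)"
      by (rule smooth_on_cong[OF oS, rotated]) (use N c d in \<open>auto simp: cinv_cmap subset_iff\<close>)
    then show "\<exists>S. open S \<and> x \<in> S \<and> smooth_on S (f \<circ> cinv d)" using oS q N by blast
  qed
qed

lemma smooth_fun_const: "smooth_fun \<A> (\<lambda>p. r)"
  by (simp add: smooth_fun_def o_def smooth_on_const)

section \<open>Bump functions and global extensions of local objects\<close>

definition bump :: "'a set \<Rightarrow> 'a \<Rightarrow> ('a \<Rightarrow> real) \<Rightarrow> 'a set \<Rightarrow> 'a set \<Rightarrow> bool" where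
  "bump \<Omega> p \<rho> C U \<longleftrightarrow> smooth_fun \<A> \<rho> \<and> closed C \<and> C \<subseteq> \<Omega> \<and> (\<forall>q. q \<notin> C \<longrightarrow> \<rho> q = 0) \<and>
     open U \<and> p \<in> U \<and> U \<subseteq> C \<and> (\<forall>q\<in>U. \<rho> q = 1)"

lemma bump_exists:
  assumes "open \<Omega>" "p \<in> \<Omega>"
  shows "\<exists>\<rho> C U. bump \<Omega> p \<rho> C U"
proof -
  obtain c where c: "c \<in> \<A>" "p \<in> cdom c" by (rule chart_cover)
  let ?W = "cmap c ` (cdom c \<inter> \<Omega>)" and ?x = "cmap c p"
  obtain e where e: "e > 0" "cball ?x e \<subseteq> ?W"
    using open_contains_cball open_chart_image[OF c(1) assms(1)] c(2) assms(2) by blast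
  \<comment> \<open>\<open>smooth_bump\<close> is only known to vanish beyond radius
    \<open>2 * r\<close>, and that ball has to fit into the given one.\<close>
  define r where "r = e / 2"
  have r: "r > 0" "cball ?x (2 * r) \<subseteq> ?W" using e by (auto simp: r_def)
  obtain \<rho> :: "'e \<Rightarrow> real" where \<rho>: "smooth_on UNIV \<rho>" "\<And>x. x \<in> cball ?x r \<Longrightarrow> \<rho> x = 1"
    "\<And>x. x \<notin> cball ?x (2 * r) \<Longrightarrow> \<rho> x = 0" using smooth_bump[OF r(1), of ?x] by blast
  define C where "C = cinv c ` cball ?x (2 * r)"
  define U where "U = cinv c ` ball ?x r"
  define \<beta> where "\<beta> q = (if q \<in> cdom c then \<rho> (cmap c q) else 0)" for q
  have hom: "homeomorphism (cmap c ` cdom c) (cdom c) (cinv c) (cmap c)"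
    using chart_homeomorphism[OF c(1)] by (rule homeomorphism_symD)
  have sub: "cball ?x (2 * r) \<subseteq> cmap c ` cdom c" using r by blast
  have bs: "ball ?x r \<subseteq> cball ?x (2 * r)" using r(1) by auto
  have "compact C"
    unfolding C_def using hom sub
    by (intro compact_continuous_image) (auto simp: homeomorphism_def intro: continuous_on_subset)
  \<comment> \<open>The Hausdorff property enters here: the compact image is closed in the whole
    space, not only in the chart domain, so extension by zero is smooth at the boundary of the chart
    as well.\<close>
  then have C: "closed C" by (rule compact_imp_closed)
  have C0: "\<beta> q = 0" if "q \<notin> C" for q
  proof (cases "q \<in> cdom c")
    case True
    then have "cmap c q \<notin> cball ?x (2 * r)" using that cinv_cmap[OF c(1) True] unfolding C_def by (metis imageI)
    then show ?thesis using \<rho>(3) by (simp add: \<beta>_def)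
  qed (simp add: \<beta>_def)
  have inv: "cinv c x \<in> cdom c \<inter> \<Omega>" "cmap c (cinv c x) = x" if "x \<in> cball ?x (2 * r)" for x
    using that r(2) cinv_cmap[OF c(1)] by (auto dest!: subsetD)
  have "openin (top_of_set (cdom c)) U"
    unfolding U_def using bs sub open_image[OF c(1)]
    by (intro homeomorphism_imp_open_map[OF hom]) (auto simp: openin_open_eq)
  then have U: "open U" using open_cdom[OF c(1)] openin_open_trans by blast
  have "smooth_fun \<A> \<beta>"
  proof (rule smooth_funI_local)
    fix q
    show "\<exists>c\<in>\<A>. \<exists>N. open N \<and> q \<in> N \<and> N \<subseteq> cdom c \<and> smooth_on (cmap c ` N) (\<beta> \<circ> cinv c)"
    proof (cases "q \<in> cdom c")
      case True
      have "smooth_on (cmap c ` cdom c) (\<beta> \<circ> cinv c)"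
        by (rule smooth_on_cong[OF open_image[OF c(1)] _ smooth_on_subset[OF \<rho>(1)]])
          (use c in \<open>auto simp: \<beta>_def cinv_cmap\<close>)
      then show ?thesis using True c open_cdom by blast
    next
      case False
      obtain d where d: "d \<in> \<A>" "q \<in> cdom d" by (rule chart_cover)
      have "q \<notin> C" using False inv unfolding C_def by auto
      have "smooth_on (cmap d ` (cdom d \<inter> - C)) (\<beta> \<circ> cinv d)"
        by (rule smooth_on_cong[OF open_chart_image[OF d(1)] _ smooth_on_const[of _ 0]])
          (use C C0 d in \<open>auto simp: cinv_cmap\<close>)
      moreover have "open (cdom d \<inter> - C)" using open_cdom[OF d(1)] C by blast
      ultimately show ?thesis using d \<open>q \<notin> C\<close> by blast
    qed
  qed
  moreover have "p \<in> U" unfolding U_def using cinv_cmap[OF c] r(1) by (metis centre_in_ball imageI)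
  moreover have "\<beta> q = 1" if "q \<in> U" for q
    using that inv bs \<rho>(2) unfolding U_def \<beta>_def by fastforce
  moreover have "U \<subseteq> C" unfolding U_def C_def using bs by blast
  moreover have "C \<subseteq> \<Omega>" unfolding C_def using inv by blast
  ultimately show ?thesis using C C0 U unfolding bump_def by blast
qed

text \<open>The product is smooth on \<open>\<Omega>\<close> and vanishes on the open complement of
  \<open>C\<close>; these cover the space because \<open>C \<subseteq> \<Omega>\<close>. This is the
  reason why \<open>bump\<close> records the closed set \<open>C\<close>.\<close>

lemma bump_extend_fun:
  assumes "bump \<Omega> p \<rho> C U" "open \<Omega>" "c \<in> \<A>" "\<Omega> \<subseteq> cdom c" "smooth_on (cmap c ` \<Omega>) (f \<circ> cinv c)"
  shows "smooth_fun \<A> (\<lambda>q. \<rho> q * (if q \<in> \<Omega> then f q else 0))"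
proof (rule smooth_funI_local)
  fix q
  have b: "smooth_fun \<A> \<rho>" "closed C" "C \<subseteq> \<Omega>" "\<And>q. q \<notin> C \<Longrightarrow> \<rho> q = 0"
    using assms(1) by (auto simp: bump_def)
  let ?f = "\<lambda>q. \<rho> q * (if q \<in> \<Omega> then f q else 0)"
  show "\<exists>c\<in>\<A>. \<exists>N. open N \<and> q \<in> N \<and> N \<subseteq> cdom c \<and> smooth_on (cmap c ` N) (?f \<circ> cinv c)"
  proof (cases "q \<in> \<Omega>")
    case True
    have o: "open (cmap c ` \<Omega>)"
      using open_chart_image[OF assms(3,2)] assms(4) by (metis Int_absorb1)
    have "smooth_on (cmap c ` \<Omega>) (\<lambda>x. (\<rho> \<circ> cinv c) x *\<^sub>R (f \<circ> cinv c) x)"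
      using b(1) assms(3,4,5) by (intro smooth_on_scaleR o) (auto simp: smooth_fun_def o_def intro: smooth_on_subset)
    then have "smooth_on (cmap c ` \<Omega>) (?f \<circ> cinv c)"
      by (rule smooth_on_cong[OF o, rotated]) (use assms in \<open>auto simp: cinv_cmap subset_iff\<close>)
    then show ?thesis using assms(2-4) True by blast
  next
    case False
    obtain d where d: "d \<in> \<A>" "q \<in> cdom d" by (rule chart_cover)
    have "smooth_on (cmap d ` (cdom d \<inter> - C)) (?f \<circ> cinv d)"
      by (rule smooth_on_cong[OF open_chart_image[OF d(1)] _ smooth_on_const[of _ 0]])
        (use b d in \<open>auto simp: cinv_cmap\<close>)
    moreover have "open (cdom d \<inter> - C)" using open_cdom[OF d(1)] b by blast
    ultimately show ?thesis using d False b by blast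
  qed
qed

lemma vfields_tangent: "X \<in> vfields_on \<A> \<Omega> \<Longrightarrow> p \<in> \<Omega> \<Longrightarrow> X p \<in> T p"
  by (simp add: vfields_on_def)

lemma vfields_smooth: "X \<in> vfields_on \<A> \<Omega> \<Longrightarrow> c \<in> \<A> \<Longrightarrow> smooth_on (cmap c ` (cdom c \<inter> \<Omega>)) (field_coords c X)"
  by (simp add: vfields_on_def)

lemma vfields_smooth_UNIV: "X \<in> vfields \<A> \<Longrightarrow> c \<in> \<A> \<Longrightarrow> smooth_on (cmap c ` cdom c) (field_coords c X)"
  using vfields_smooth by fastforce

lemma bump_extend_field:
  assumes "bump \<Omega> p \<rho> C U" "open \<Omega>" "X \<in> vfields_on \<A> \<Omega>"
  shows "(\<lambda>q. \<rho> q *\<^sub>R (if q \<in> \<Omega> then X q else 0)) \<in> vfields \<A>"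
proof (rule vfields_onI_local)
  fix q
  have b: "smooth_fun \<A> \<rho>" "closed C" "C \<subseteq> \<Omega>" "\<And>q. q \<notin> C \<Longrightarrow> \<rho> q = 0"
    using assms(1) by (auto simp: bump_def)
  let ?f = "\<lambda>q. \<rho> q *\<^sub>R (if q \<in> \<Omega> then X q else 0)"
  show "?f q \<in> T q"
    using vfields_tangent[OF assms(3)] subspace_tangent by (auto intro: subspace_scale subspace_0)
  obtain d where d: "d \<in> \<A>" "q \<in> cdom d" by (rule chart_cover)
  show "\<exists>c\<in>\<A>. \<exists>N. open N \<and> q \<in> N \<and> N \<subseteq> cdom c \<inter> UNIV \<and> smooth_on (cmap c ` N) (field_coords c ?f)"
  proof (cases "q \<in> \<Omega>")
    case True
    have o: "open (cmap d ` (cdom d \<inter> \<Omega>))"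
      by (rule open_chart_image[OF d(1) assms(2)])
    have "smooth_on (cmap d ` (cdom d \<inter> \<Omega>)) (\<lambda>x. (\<rho> \<circ> cinv d) x *\<^sub>R field_coords d X x)"
      using b(1) d(1) by (intro smooth_on_scaleR o vfields_smooth assms(3))
        (auto simp: smooth_fun_def o_def intro: smooth_on_subset)
    then have "smooth_on (cmap d ` (cdom d \<inter> \<Omega>)) (field_coords d ?f)"
      by (rule smooth_on_cong[OF o, rotated]) (use d in \<open>auto simp: cinv_cmap\<close>)
    moreover have "open (cdom d \<inter> \<Omega>)" using open_cdom[OF d(1)] assms(2) by blast
    ultimately show ?thesis using d True by blast
  next
    case False
    have "smooth_on (cmap d ` (cdom d \<inter> - C)) (field_coords d ?f)"
      by (rule smooth_on_cong[OF open_chart_image[OF d(1)] _ smooth_on_const[of _ 0]])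
        (use b d in \<open>auto simp: cinv_cmap\<close>)
    moreover have "open (cdom d \<inter> - C)" using open_cdom[OF d(1)] b by blast
    ultimately show ?thesis using d False b by blast
  qed
qed

lemma local_field_extend:
  assumes "open \<Omega>" "p \<in> \<Omega>" "W \<in> vfields_on \<A> \<Omega>"
  obtains W' U where "W' \<in> vfields \<A>" "open U" "p \<in> U" "U \<subseteq> \<Omega>" "\<And>q. q \<in> U \<Longrightarrow> W' q = W q"
proof -
  obtain \<rho> C U where b: "bump \<Omega> p \<rho> C U" using bump_exists[OF assms(1,2)] by blast
  show ?thesis
    by (rule that[OF bump_extend_field[OF b assms(1,3)], of U]) (use b in \<open>auto simp: bump_def\<close>)
qed

lemma coordinate_field:
  assumes c: "c \<in> \<A>"
  shows "(\<lambda>q. tvec_of c q a) \<in> vfields_on \<A> (cdom c)"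
proof (rule vfields_onI_local)
  show "tvec_of c q a \<in> T q" if "q \<in> cdom c" for q using tvec_of_tangent[OF c that] .
  have "smooth_on (cmap c ` cdom c) (field_coords c (\<lambda>q. tvec_of c q a))"
    by (rule smooth_on_cong[OF open_image[OF c] _ smooth_on_const[of _ a]])
      (use c in \<open>auto simp: cinv_cmap coords_tvec_of\<close>)
  then show "\<exists>d\<in>\<A>. \<exists>N. open N \<and> q \<in> N \<and> N \<subseteq> cdom d \<inter> cdom c \<and>
      smooth_on (cmap d ` N) (field_coords d (\<lambda>q. tvec_of c q a))" if "q \<in> cdom c" for q
    using that c open_cdom[OF c] by blast
qed

text \<open>This keeps the descriptions in \<open>on_vectors2\<close> and \<open>on_vectors3\<close>
  from being vacuous.\<close>

lemma tangent_extend: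
  assumes "x \<in> T p"
  obtains X where "X \<in> vfields \<A>" "X p = x"
proof -
  obtain c where c: "c \<in> \<A>" "p \<in> cdom c" by (rule chart_cover)
  obtain X U where X: "X \<in> vfields \<A>" "p \<in> U" "\<And>q. q \<in> U \<Longrightarrow> X q = tvec_of c q (coords x c)"
    using local_field_extend[OF open_cdom[OF c(1)] c(2) coordinate_field[OF c(1)]] by metis
  have "tvec_of c p (coords x c) = x"
    by (rule tangent_eqI[OF tvec_of_tangent[OF c] assms c]) (simp add: coords_tvec_of c)
  then show ?thesis using that X by metis
qed

text \<open>Coordinate fields live on a chart, while a connection takes global fields. A bump
  function makes them global and leaves them unchanged near \<open>p\<close>.\<close>

lemma coordinate_frame:
  assumes c: "c \<in> \<A>" and p: "p \<in> cdom c"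
  obtains E U where "open U" "p \<in> U" "U \<subseteq> cdom c" "\<And>b. E b \<in> vfields \<A>" "\<And>b q. q \<in> U \<Longrightarrow> coords (E b q) c = b"
proof -
  obtain \<rho> C U where b: "bump (cdom c) p \<rho> C U" using bump_exists[OF open_cdom[OF c] p] by blast
  show ?thesis
    by (rule that[of U "\<lambda>b q. \<rho> q *\<^sub>R (if q \<in> cdom c then tvec_of c q b else 0)"])
      (use b bump_extend_field[OF b open_cdom[OF c] coordinate_field[OF c]] in
        \<open>auto simp: bump_def coords_tvec_of c\<close>)
qed

section \<open>The module of vector fields, directional derivatives and the Lie bracket\<close>

lemma vfields_add:
  assumes "X \<in> vfields \<A>" "Y \<in> vfields \<A>"
  shows "(\<lambda>p. X p + Y p) \<in> vfields \<A>"
  using assms subspace_add[OF subspace_tangent]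
  by (auto simp: vfields_on_def intro!: smooth_on_add open_image)

lemma vfields_zero: "(\<lambda>p. 0) \<in> vfields \<A>"
  using subspace_0[OF subspace_tangent] by (auto simp: vfields_on_def smooth_on_const)

lemma vfields_scale:
  assumes "smooth_fun \<A> f" "X \<in> vfields \<A>"
  shows "(\<lambda>p. f p *\<^sub>R X p) \<in> vfields \<A>"
  using assms subspace_scale[OF subspace_tangent]
  by (auto simp: vfields_on_def smooth_fun_def o_def intro!: smooth_on_scaleR open_image)

lemma vfields_sum:
  "(\<And>i. i \<in> I \<Longrightarrow> X i \<in> vfields \<A>) \<Longrightarrow> (\<lambda>p. \<Sum>i\<in>I. X i p) \<in> vfields \<A>"
  by (induction I rule: infinite_finite_induct) (auto intro: vfields_zero vfields_add)

text \<open>\<open>deriv_along\<close> chooses a chart. The changes of \<open>f\<close> and of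
  \<open>x\<close> under a transition compensate each other, so every chart gives the same
  value.\<close>

lemma deriv_along_chart:
  assumes f: "smooth_fun \<A> f" and x: "x \<in> T p" and c: "c \<in> \<A>" "p \<in> cdom c"
  shows "deriv_along \<A> p x f = FD (f \<circ> cinv c) (cmap c p) (coords x c)"
proof -
  define d where "d = (SOME c. c \<in> \<A> \<and> p \<in> cdom c)"
  have d: "d \<in> \<A>" "p \<in> cdom d" using someI[of "\<lambda>c. c \<in> \<A> \<and> p \<in> cdom c" c] c by (auto simp: d_def)
  have "(f \<circ> cinv d) differentiable at (cmap d p)"
    by (rule smooth_on_differentiable[of "cmap d ` cdom d"]) (use f d in \<open>auto simp: smooth_fun_def\<close>)
  then have "FD (f \<circ> cinv c) (cmap c p) (coords x c) = FD (f \<circ> cinv d) (cmap d p) (coords x d)"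
    using FD_eq[OF chart_change[OF c(1) d(1) c(2) d(2)], of f] tangent_coords[OF x c(1) d(1) c(2) d(2)] by simp
  then show ?thesis by (simp add: deriv_along_def Let_def d_def)
qed

lemma coords_lie_bracket:
  assumes "c \<in> \<A>" "p \<in> cdom c"
  shows "coords (lie_bracket \<A> X Y p) c = FD (field_coords c Y) (cmap c p) (coords (X p) c)
    - FD (field_coords c X) (cmap c p) (coords (Y p) c)"
  using assms by (simp add: lie_bracket_def)

text \<open>The second derivatives of the transition map cancel by symmetry.\<close>

lemma lie_bracket_vfields:
  assumes X: "X \<in> vfields \<A>" and Y: "Y \<in> vfields \<A>"
  shows "lie_bracket \<A> X Y \<in> vfields \<A>"
  unfolding vfields_on_def
proof safe
  fix p :: 'a
  show "lie_bracket \<A> X Y p \<in> T p"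
  proof (rule tangentI)
    show "coords (lie_bracket \<A> X Y p) d = 0" if "\<not> (d \<in> \<A> \<and> p \<in> cdom d)" for d
      using that by (auto simp: lie_bracket_def)
    fix c d assume c: "c \<in> \<A>" "p \<in> cdom c" and d: "d \<in> \<A>" "p \<in> cdom d"
    let ?t = "cmap d \<circ> cinv c" and ?x = "cmap c p" and ?S = "cmap c ` (cdom c \<inter> cdom d)"
    have oS: "open ?S" "?x \<in> ?S" using open_chart_image[OF c(1) open_cdom[OF d(1)]] c d by auto
    have t: "smooth_on ?S ?t" using smooth_transition[OF c(1) d(1)] .
    have diff: "field_coords e Z differentiable at (cmap e p)"
      if "Z \<in> vfields \<A>" "e \<in> \<A>" "p \<in> cdom e" for Z e
      using smooth_on_differentiable[OF vfields_smooth_UNIV[OF that(1,2)]] that(3) by blast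
    \<comment> \<open>The components of \<open>Z\<close> in \<open>d\<close> are differentiated in
      two ways, through the transformation law in \<open>c\<close> and through
      \<open>chart_change\<close>. The \<open>D2\<close> term is the non-tensorial part; it is
      symmetric in the two fields once \<open>h\<close> is the other one.\<close>
    have *: "FD (field_coords d Z) (cmap d p) (FD ?t ?x h)
        = D2 ?t ?x h (coords (Z p) c) + FD ?t ?x (FD (field_coords c Z) ?x h)" if Z: "Z \<in> vfields \<A>" for Z h
    proof -
      have "((\<lambda>y. FD ?t y (field_coords c Z y)) has_derivative
          (\<lambda>h. D2 ?t ?x h (field_coords c Z ?x) + FD ?t ?x (FD (field_coords c Z) ?x h))) (at ?x)"
        by (rule has_derivative_FD[OF oS t FD_works[OF diff[OF Z c]]])
      moreover have "FD ?t y (field_coords c Z y) = ((\<lambda>q. coords (Z q) d) \<circ> cinv c) y" if "y \<in> ?S" for y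
        using that c d tangent_coords[OF vfields_tangent[OF Z UNIV_I] c(1) d(1)] by (auto simp: cinv_cmap)
      ultimately have 1: "(((\<lambda>q. coords (Z q) d) \<circ> cinv c) has_derivative
          (\<lambda>h. D2 ?t ?x h (field_coords c Z ?x) + FD ?t ?x (FD (field_coords c Z) ?x h))) (at ?x)"
        using has_derivative_transform_within_open[OF _ oS] by blast
      have 2: "(((\<lambda>q. coords (Z q) d) \<circ> cinv c) has_derivative
          (\<lambda>h. FD ((\<lambda>q. coords (Z q) d) \<circ> cinv d) (cmap d p) (FD ?t ?x h))) (at ?x)"
        by (rule chart_change[OF c(1) d(1) c(2) d(2)]) (simp add: o_def diff[OF Z d])
      show ?thesis
        using fun_cong[OF has_derivative_unique[OF 1 2], of h] cinv_cmap[OF c] by (simp add: o_def)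
    qed
    have tc: "coords (Z p) d = FD ?t ?x (coords (Z p) c)" if "Z \<in> vfields \<A>" for Z
      using tangent_coords[OF vfields_tangent[OF that UNIV_I] c(1) d(1) c(2) d(2)] .
    show "coords (lie_bracket \<A> X Y p) d = FD ?t ?x (coords (lie_bracket \<A> X Y p) c)"
      unfolding coords_lie_bracket[OF c] coords_lie_bracket[OF d] tc[OF X] tc[OF Y] *[OF X] *[OF Y]
      using D2_symmetric[OF oS t] linear_diff[OF transition_linear[OF c(1) d(1) c(2) d(2)]] by simp
  qed
next
  fix c assume c: "c \<in> \<A>"
  have "smooth_on (cmap c ` cdom c) (\<lambda>x. FD (field_coords c Y) x (field_coords c X x)
      - FD (field_coords c X) x (field_coords c Y x))"
    using X Y c by (intro smooth_on_diff smooth_on_FD[where a = "\<lambda>x. x" and T = "cmap c ` cdom c"]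
        open_image vfields_smooth_UNIV smooth_on_bounded_linear bounded_linear_ident) auto
  then have "smooth_on (cmap c ` cdom c) (field_coords c (lie_bracket \<A> X Y))"
    by (rule smooth_on_cong[OF open_image[OF c], rotated]) (use c in \<open>auto simp: coords_lie_bracket cinv_cmap\<close>)
  then show "smooth_on (cmap c ` (cdom c \<inter> UNIV)) (field_coords c (lie_bracket \<A> X Y))" by simp
qed

end

section \<open>Anisotropic fields in charts\<close>

text \<open>\<open>has_derivative_linear_family\<close> used once for each argument.
  \<open>B\<close> will be a Christoffel symbol varying over the tangent bundle.\<close>

lemma has_derivative_bilinear_family:
  fixes B :: "'x::real_normed_vector \<Rightarrow> 'a::euclidean_space \<Rightarrow> 'b::euclidean_space \<Rightarrow> 'c::real_normed_vector"
  assumes S: "open S" "x \<in> S"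
    and lin: "\<And>y b. y \<in> S \<Longrightarrow> linear (\<lambda>a. B y a b)" "\<And>y a. y \<in> S \<Longrightarrow> linear (B y a)"
    and B: "\<And>a b. (\<lambda>y. B y a b) differentiable at x"
    and f: "(f has_derivative f') (at x)" and g: "(g has_derivative g') (at x)"
  shows "((\<lambda>y. B y (f y) (g y)) has_derivative
    (\<lambda>h. FD (\<lambda>y. B y (f x) (g x)) x h + B x (f' h) (g x) + B x (f x) (g' h))) (at x)"
proof (rule has_derivative_linear_family[OF S _ _ g])
  show "linear (B y (f y))" if "y \<in> S" for y using lin(2)[OF that] .
  show "((\<lambda>y. B y (f y) b) has_derivative (\<lambda>h. FD (\<lambda>y. B y (f x) b) x h + B x (f' h) b)) (at x)" for b
    by (rule has_derivative_linear_family[OF S _ _ f, of "\<lambda>y a. B y a b"]) (auto intro: lin FD_works B)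
qed

locale aniso_domain = smooth_manifold \<A>
  for \<A> :: "('a::{t2_space,second_countable_topology}, 'e::euclidean_space) chart set" +
  fixes A :: "('a, 'e) tpoint set"
  assumes A_open: "open_in_tangent_bundle \<A> A"
begin

section \<open>The tangent bundle in its induced charts\<close>

lemma A_tangent: "v \<in> A \<Longrightarrow> snd v \<in> T (fst v)"
  using A_open unfolding open_in_tangent_bundle_def tangent_bundle_def by blast

text \<open>\<open>tinv\<close> is an \<open>inv_into\<close>; injectivity makes it recover the
  original point.\<close>

lemma tmap_inj:
  assumes "c \<in> \<A>"
  shows "inj_on (tmap c) (tdom \<A> c)"
proof (rule inj_onI)
  fix v w assume "v \<in> tdom \<A> c" "w \<in> tdom \<A> c" and e: "tmap c v = tmap c w"
  then have v: "snd v \<in> T (fst v)" "fst v \<in> cdom c" and w: "snd w \<in> T (fst w)" "fst w \<in> cdom c"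
    by (auto simp: tdom_def tangent_bundle_def)
  have "fst v = fst w" using e cinv_cmap[OF assms] v(2) w(2) by (metis tmap_def prod.inject)
  moreover from this have "snd v = snd w"
    using tangent_eqI[OF v(1) _ assms v(2)] w(1) e by (simp add: tmap_def)
  ultimately show "v = w" by (rule prod_eqI)
qed

lemma tdomI: "c \<in> \<A> \<Longrightarrow> snd v \<in> T (fst v) \<Longrightarrow> fst v \<in> cdom c \<Longrightarrow> v \<in> tdom \<A> c"
  by (simp add: tdom_def tangent_bundle_def)

lemma tinv_tmap:
  assumes "c \<in> \<A>" "v \<in> A" "fst v \<in> cdom c"
  shows "tinv \<A> c (tmap c v) = v"
  unfolding tinv_def using assms tmap_inj tdomI A_tangent by (metis inv_into_f_f)

definition over :: "('a, 'e) chart \<Rightarrow> 'a set \<Rightarrow> ('e \<times> 'e) set" where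
  "over c N = tmap c ` {v \<in> A. fst v \<in> N}"

lemma over_cdom: "c \<in> \<A> \<Longrightarrow> over c (cdom c) = tmap c ` (A \<inter> tdom \<A> c)"
  unfolding over_def by (rule arg_cong[where f = "\<lambda>S. tmap c ` S"])
    (auto simp: tdom_def tangent_bundle_def dest: A_tangent)

lemma open_over:
  assumes c: "c \<in> \<A>" and N: "open N" "N \<subseteq> cdom c"
  shows "open (over c N)"
proof -
  have "over c N = tmap c ` (A \<inter> tdom \<A> c) \<inter> (cmap c ` (cdom c \<inter> N)) \<times> UNIV"
    unfolding over_cdom[OF c, symmetric] unfolding over_def
    using N(2) by (auto simp: tmap_def image_iff subset_iff) (metis c cinv_cmap)
  moreover have "open (tmap c ` (A \<inter> tdom \<A> c))"
    using A_open c unfolding open_in_tangent_bundle_def by blast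
  ultimately show ?thesis using open_chart_image[OF c N(1)] by (simp add: open_Times open_Int)
qed

abbreviation aniso_coords :: "('a, 'e) chart \<Rightarrow> (('a, 'e) tpoint \<Rightarrow> ('a, 'e) tvec) \<Rightarrow> 'e \<times> 'e \<Rightarrow> 'e" where
  "aniso_coords c \<Y> \<equiv> \<lambda>\<xi>. coords (\<Y> (tinv \<A> c \<xi>)) c"

lemma aniso_fields_tangent: "\<Y> \<in> aniso_fields \<A> A \<Longrightarrow> v \<in> A \<Longrightarrow> \<Y> v \<in> T (fst v)"
  by (simp add: aniso_fields_def)

lemma aniso_fields_smooth: "\<Y> \<in> aniso_fields \<A> A \<Longrightarrow> c \<in> \<A> \<Longrightarrow> smooth_on (over c (cdom c)) (aniso_coords c \<Y>)"
  by (simp add: aniso_fields_def over_cdom)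

lemma vfield_aniso:
  assumes "X \<in> vfields \<A>"
  shows "(\<lambda>v. X (fst v)) \<in> aniso_fields \<A> A"
  unfolding aniso_fields_def
proof safe
  show "X (fst v) \<in> T (fst v)" for v :: "('a, 'e) tpoint" using vfields_tangent[OF assms UNIV_I] .
  fix c assume c: "c \<in> \<A>"
  have o: "open (over c (cdom c))" using open_over[OF c open_cdom[OF c]] by simp
  have "smooth_on (over c (cdom c)) (\<lambda>\<xi>. field_coords c X (fst \<xi>))"
    by (rule smooth_on_compose[OF o open_image[OF c] smooth_on_bounded_linear[OF bounded_linear_fst] vfields_smooth_UNIV[OF assms c]])
      (auto simp: over_def tmap_def)
  then have "smooth_on (over c (cdom c)) (aniso_coords c (\<lambda>v. X (fst v)))"
    by (rule smooth_on_cong[OF o, rotated]) (use c in \<open>auto simp: over_def tinv_tmap tmap_def cinv_cmap\<close>,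
      metis c cinv_cmap tinv_tmap fst_conv tmap_def snd_conv)
  then show "smooth_on (tmap c ` (A \<inter> tdom \<A> c)) (aniso_coords c (\<lambda>v. X (fst v)))"
    by (simp add: over_cdom c)
qed

text \<open>Ensures that the curve differentiated in \<open>vertical_deriv\<close> stays in
  \<open>A\<close> for small parameters of both signs. The image of the line in the chart stays in
  an open set, and injectivity of \<open>tmap\<close> brings this back to the bundle.\<close>

lemma fibre_open:
  assumes v: "v \<in> A" and z: "z \<in> T (fst v)"
  obtains S where "open S" "(0::real) \<in> S" "\<And>t. t \<in> S \<Longrightarrow> (fst v, snd v + t *\<^sub>R z) \<in> A"
proof -
  obtain c where c: "c \<in> \<A>" "fst v \<in> cdom c" by (rule chart_cover)
  let ?f = "\<lambda>t. tmap c v + t *\<^sub>R (0, coords z c)"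
  let ?S = "?f -` over c (cdom c)"
  have "open ?S"
    by (intro open_vimage open_over c open_cdom continuous_intros) simp
  moreover have "0 \<in> ?S" using v c by (simp add: over_def zero_prod_def[symmetric])
  moreover have "(fst v, snd v + t *\<^sub>R z) \<in> A" if "t \<in> ?S" for t
  proof -
    obtain w where w: "w \<in> A" "fst w \<in> cdom c" "?f t = tmap c w"
      using \<open>t \<in> ?S\<close> by (auto simp: over_def)
    have "snd v + t *\<^sub>R z \<in> T (fst v)"
      using subspace_tangent z A_tangent[OF v] by (simp add: subspace_add subspace_scale)
    moreover have "?f t = tmap c (fst v, snd v + t *\<^sub>R z)" by (simp add: tmap_def)
    ultimately have "(fst v, snd v + t *\<^sub>R z) = w"
      by (intro inj_onD[OF tmap_inj[OF c(1)]]) (use w c A_tangent in \<open>auto intro!: tdomI\<close>)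
    then show ?thesis using w by simp
  qed
  ultimately show ?thesis using that by blast
qed

text \<open>\<open>vertical_deriv\<close> differentiates in each chart separately. Along a fibre the
  transition derivative is one fixed linear map, which commutes with the derivative in
  \<open>t\<close>, so the results fit together to a tangent vector.\<close>

lemma vertical_deriv_coords:
  assumes v: "v \<in> A" and z: "z \<in> T (fst v)" and c: "c \<in> \<A>" "fst v \<in> cdom c"
    and Y: "\<And>v'. v' \<in> A \<Longrightarrow> fst v' = fst v \<Longrightarrow> \<Y> v' \<in> T (fst v)"
    and G: "(G has_derivative G') (at (tmap c v))"
    and YG: "\<And>v'. v' \<in> A \<Longrightarrow> fst v' = fst v \<Longrightarrow> coords (\<Y> v') c = G (tmap c v')"
  shows "vertical_deriv \<Y> v z \<in> T (fst v)" "coords (vertical_deriv \<Y> v z) c = G' (0, coords z c)"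
proof -
  obtain S where S: "open S" "(0::real) \<in> S" "\<And>t. t \<in> S \<Longrightarrow> (fst v, snd v + t *\<^sub>R z) \<in> A"
    using fibre_open[OF v z] by blast
  let ?Y = "\<lambda>t. \<Y> (fst v, snd v + t *\<^sub>R z)"
  have Y': "?Y t \<in> T (fst v)" if "t \<in> S" for t using Y[OF S(3)[OF that]] by simp
  have "((\<lambda>t. G (tmap c v + t *\<^sub>R (0, coords z c))) has_derivative (\<lambda>t. G' (t *\<^sub>R (0, coords z c)))) (at 0)"
    by (rule has_derivative_compose[where f = "\<lambda>t. tmap c v + t *\<^sub>R (0, coords z c)"])
      (auto intro!: derivative_eq_intros simp: G zero_prod_def[symmetric])
  then have "((\<lambda>t. G (tmap c v + t *\<^sub>R (0, coords z c))) has_vector_derivative G' (0, coords z c)) (at 0)"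
    unfolding has_vector_derivative_def
    using linear_cmul[OF has_derivative_linear[OF G], of _ "(0, coords z c)"] by simp
  then have c': "((\<lambda>t. coords (?Y t) c) has_vector_derivative G' (0, coords z c)) (at 0)"
  proof (rule has_vector_derivative_transform_within_open[OF _ S(1,2)])
    show "G (tmap c v + t *\<^sub>R (0, coords z c)) = coords (?Y t) c" if "t \<in> S" for t
      using YG[OF S(3)[OF that]] by (simp add: tmap_def)
  qed
  have d': "((\<lambda>t. coords (?Y t) d) has_vector_derivative FD (cmap d \<circ> cinv c) (cmap c (fst v)) (G' (0, coords z c))) (at 0)"
    if d: "d \<in> \<A>" "fst v \<in> cdom d" for d
  proof (rule has_vector_derivative_transform_within_open[OF _ S(1,2)])
    show "((\<lambda>t. FD (cmap d \<circ> cinv c) (cmap c (fst v)) (coords (?Y t) c)) has_vector_derivative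
        FD (cmap d \<circ> cinv c) (cmap c (fst v)) (G' (0, coords z c))) (at 0)"
      using bounded_linear.has_vector_derivative[OF _ c'] transition_linear[OF c(1) d(1) c(2) d(2)]
      unfolding linear_conv_bounded_linear by blast
    show "FD (cmap d \<circ> cinv c) (cmap c (fst v)) (coords (?Y t) c) = coords (?Y t) d" if "t \<in> S" for t
      using tangent_coords[OF Y'[OF that] c(1) d(1) c(2) d(2)] by simp
  qed
  have vd: "coords (vertical_deriv \<Y> v z) d = FD (cmap d \<circ> cinv c) (cmap c (fst v)) (G' (0, coords z c))"
    if d: "d \<in> \<A>" "fst v \<in> cdom d" for d
    using vector_derivative_at[OF d'[OF d]] by (simp add: vertical_deriv_def)
  show vc: "coords (vertical_deriv \<Y> v z) c = G' (0, coords z c)"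
    using vector_derivative_at[OF c'] by (simp add: vertical_deriv_def)
  \<comment> \<open>In a chart that is not around the base point the coordinates are constantly 0
    near \<open>t = 0\<close>, so the derivative keeps the default value.\<close>
  have out: "coords (vertical_deriv \<Y> v z) d = 0" if "\<not> (d \<in> \<A> \<and> fst v \<in> cdom d)" for d
  proof -
    have "((\<lambda>t. coords (?Y t) d) has_vector_derivative 0) (at 0)"
      by (rule has_vector_derivative_transform_within_open[OF has_vector_derivative_const[of 0] S(1,2)])
        (use tangent_coords_outside[OF Y' that] in auto)
    then show ?thesis using vector_derivative_at by (fastforce simp: vertical_deriv_def)
  qed
  show "vertical_deriv \<Y> v z \<in> T (fst v)"
  proof (rule tangentI)
    fix e d assume e: "e \<in> \<A>" and d: "d \<in> \<A>" and p: "fst v \<in> cdom e" "fst v \<in> cdom d"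
    show "coords (vertical_deriv \<Y> v z) d
        = FD (cmap d \<circ> cinv e) (cmap e (fst v)) (coords (vertical_deriv \<Y> v z) e)"
      unfolding vd[OF d p(2)] vd[OF e p(1)] by (rule transition_cocycle[OF c(1) e d c(2) p])
  qed (rule out)
qed

text \<open>This is the field to which \<open>conn_aniso\<close> applies \<open>conn_local\<close>;
  in a chart it is the representative of \<open>\<Y>\<close> composed with the graph of
  \<open>V\<close>.\<close>

lemma aniso_along_field:
  assumes Y: "\<Y> \<in> aniso_fields \<A> A" and V: "admissible_on \<A> A \<Omega> V"
  shows "(\<lambda>p. \<Y> (p, V p)) \<in> vfields_on \<A> \<Omega>"
    and "\<And>c x. c \<in> \<A> \<Longrightarrow> x \<in> cmap c ` (cdom c \<inter> \<Omega>) \<Longrightarrow>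
      field_coords c (\<lambda>p. \<Y> (p, V p)) x = aniso_coords c \<Y> (x, field_coords c V x)"
proof -
  have V': "open \<Omega>" "V \<in> vfields_on \<A> \<Omega>" "\<And>p. p \<in> \<Omega> \<Longrightarrow> (p, V p) \<in> A"
    using V by (auto simp: admissible_on_def)
  show *: "field_coords c (\<lambda>p. \<Y> (p, V p)) x = aniso_coords c \<Y> (x, field_coords c V x)"
    if "c \<in> \<A>" "x \<in> cmap c ` (cdom c \<inter> \<Omega>)" for c x
    using that tinv_tmap[OF that(1) V'(3)] by (auto simp: cinv_cmap tmap_def)
  show "(\<lambda>p. \<Y> (p, V p)) \<in> vfields_on \<A> \<Omega>"
    unfolding vfields_on_def
  proof safe
    show "\<Y> (p, V p) \<in> T p" if "p \<in> \<Omega>" for p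
      using aniso_fields_tangent[OF Y V'(3)[OF that]] by simp
    fix c assume c: "c \<in> \<A>"
    have o: "open (cmap c ` (cdom c \<inter> \<Omega>))" using open_chart_image[OF c V'(1)] .
    have "smooth_on (cmap c ` (cdom c \<inter> \<Omega>)) (\<lambda>x. aniso_coords c \<Y> (x, field_coords c V x))"
    proof (rule smooth_on_compose[OF o open_over[OF c open_cdom[OF c] subset_refl] _ aniso_fields_smooth[OF Y c]])
      show "smooth_on (cmap c ` (cdom c \<inter> \<Omega>)) (\<lambda>x. (x, field_coords c V x))"
        by (intro smooth_on_Pair o vfields_smooth V' c smooth_on_bounded_linear bounded_linear_ident)
      show "(\<lambda>x. (x, field_coords c V x)) ` cmap c ` (cdom c \<inter> \<Omega>) \<subseteq> over c (cdom c)"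
        using V'(3) c by (force simp: over_def tmap_def cinv_cmap)
    qed
    then show "smooth_on (cmap c ` (cdom c \<inter> \<Omega>)) (field_coords c (\<lambda>p. \<Y> (p, V p)))"
      by (rule smooth_on_cong[OF o, rotated]) (use * c in auto)
  qed
qed

lemma vfields_on_subset: "X \<in> vfields_on \<A> \<Omega> \<Longrightarrow> \<Omega>' \<subseteq> \<Omega> \<Longrightarrow> X \<in> vfields_on \<A> \<Omega>'"
  unfolding vfields_on_def by (auto elim!: ballE[where P = "\<lambda>c. smooth_on _ _"] intro: smooth_on_subset)

text \<open>The field with constant coordinates in a chart stays in \<open>A\<close> near the base
  point because \<open>A\<close> is open. Hence the description in \<open>conn_aniso\<close> is not
  vacuous.\<close>

lemma admissible_extension:
  assumes v: "v \<in> A"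
  obtains \<Omega> V where "admissible_on \<A> A \<Omega> V" "fst v \<in> \<Omega>" "V (fst v) = snd v"
proof -
  obtain c where c: "c \<in> \<A>" "fst v \<in> cdom c" by (rule chart_cover)
  define V where "V p = tvec_of c p (coords (snd v) c)" for p
  define \<Omega> where "\<Omega> = {p \<in> cdom c. (p, V p) \<in> A}"
  have Vv: "V (fst v) = snd v"
    unfolding V_def
    by (rule tangent_eqI[OF tvec_of_tangent[OF c] A_tangent[OF v] c]) (simp add: coords_tvec_of c)
  have "p \<in> cdom c \<Longrightarrow> (p, V p) \<in> A \<longleftrightarrow> (cmap c p, coords (snd v) c) \<in> over c (cdom c)" for p
  proof -
    assume p: "p \<in> cdom c"
    have t: "tmap c (p, V p) = (cmap c p, coords (snd v) c)"
      by (simp add: tmap_def V_def coords_tvec_of c(1) p)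
    have d: "(p, V p) \<in> tdom \<A> c" by (rule tdomI) (simp_all add: c p V_def tvec_of_tangent)
    show ?thesis
      unfolding t[symmetric] over_cdom[OF c(1)]
      using d inj_onD[OF tmap_inj[OF c(1)] _ d] by auto
  qed
  then have "\<Omega> = cdom c \<inter> cmap c -` ((\<lambda>x. (x, coords (snd v) c)) -` over c (cdom c))"
    unfolding \<Omega>_def by auto
  moreover have "open ((\<lambda>x. (x, coords (snd v) c)) -` over c (cdom c))"
    by (intro open_vimage open_over c open_cdom continuous_intros) simp
  ultimately have "open \<Omega>"
    using chart_homeomorphism[OF c(1)] open_cdom[OF c(1)]
    by (auto simp: homeomorphism_def intro: continuous_open_preimage)
  moreover have "V \<in> vfields_on \<A> \<Omega>"
    unfolding V_def by (rule vfields_on_subset[OF coordinate_field[OF c(1)]]) (auto simp: \<Omega>_def)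
  ultimately have "admissible_on \<A> A \<Omega> V" by (simp add: admissible_on_def \<Omega>_def)
  then show ?thesis using that Vv c v by (simp add: \<Omega>_def prod_eq_iff)
qed

end

section \<open>Christoffel symbols of an anisotropic connection\<close>

context aniso_domain
begin

definition frame :: "('a, 'e) chart \<Rightarrow> ('e \<Rightarrow> 'a \<Rightarrow> ('a, 'e) tvec) \<Rightarrow> 'a set \<Rightarrow> bool" where
  "frame c E U \<longleftrightarrow> c \<in> \<A> \<and> open U \<and> U \<subseteq> cdom c \<and> (\<forall>b. E b \<in> vfields \<A>) \<and>
    (\<forall>b. \<forall>q\<in>U. coords (E b q) c = b)"

lemma frameD:
  assumes "frame c E U"
  shows "c \<in> \<A>" "open U" "U \<subseteq> cdom c" "\<And>b. E b \<in> vfields \<A>" "\<And>b q. q \<in> U \<Longrightarrow> coords (E b q) c = b"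
  using assms by (auto simp: frame_def)

lemma frame_exists:
  obtains c E U where "frame c E U" "p \<in> U"
proof -
  obtain c where "c \<in> \<A>" "p \<in> cdom c" by (rule chart_cover)
  then show ?thesis using coordinate_frame[of c p] that unfolding frame_def by metis
qed

text \<open>Extending bilinearly from the basis makes the symbol bilinear at every
  \<open>\<xi>\<close>, also outside the region where \<open>E\<close> is a coordinate frame. The
  product rules can therefore be used without restricting the domain.\<close>

definition christoffel ::
  "('a, 'e) conn \<Rightarrow> ('a, 'e) chart \<Rightarrow> ('e \<Rightarrow> 'a \<Rightarrow> ('a, 'e) tvec) \<Rightarrow> 'e \<times> 'e \<Rightarrow> 'e \<Rightarrow> 'e \<Rightarrow> 'e" where
  "christoffel D c E \<xi> a b =
    (\<Sum>j\<in>Basis. (b \<bullet> j) *\<^sub>R (\<Sum>i\<in>Basis. (a \<bullet> i) *\<^sub>R coords (D (tinv \<A> c \<xi>) (E i) (E j)) c))"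

lemma linear_christoffel_left: "linear (\<lambda>a. christoffel D c E \<xi> a b)"
  unfolding christoffel_def
  by (intro linear_compose_sum ballI linear_compose_scale_right linearI)
    (simp_all add: inner_add_left scaleR_add_left sum.distrib scaleR_sum_right algebra_simps)

lemma linear_christoffel_right: "linear (christoffel D c E \<xi> a)"
  unfolding christoffel_def
  by (intro linearI) (simp_all add: inner_add_left scaleR_add_left sum.distrib scaleR_sum_right[symmetric] sum_distrib_left flip: scaleR_scaleR)

end

locale aniso_conn = aniso_domain \<A> A
  for \<A> :: "('a::{t2_space,second_countable_topology}, 'e::euclidean_space) chart set" and A +
  fixes D :: "('a, 'e) conn"
  assumes conn: "aniso_connection \<A> A D"
begin

section \<open>Algebraic rules of a connection\<close>

lemma conn_aniso_field: "X \<in> vfields \<A> \<Longrightarrow> Y \<in> vfields \<A> \<Longrightarrow> (\<lambda>v. D v X Y) \<in> aniso_fields \<A> A"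
  using conn by (simp add: aniso_connection_def)

lemma conn_tangent: "v \<in> A \<Longrightarrow> X \<in> vfields \<A> \<Longrightarrow> Y \<in> vfields \<A> \<Longrightarrow> D v X Y \<in> T (fst v)"
  using aniso_fields_tangent[OF conn_aniso_field] by simp

lemma conn_add:
  "v \<in> A \<Longrightarrow> X \<in> vfields \<A> \<Longrightarrow> Y \<in> vfields \<A> \<Longrightarrow> Z \<in> vfields \<A> \<Longrightarrow>
    D v X (\<lambda>p. Y p + Z p) = D v X Y + D v X Z"
  using conn by (simp add: aniso_connection_def)

lemma conn_leibniz:
  "v \<in> A \<Longrightarrow> X \<in> vfields \<A> \<Longrightarrow> Y \<in> vfields \<A> \<Longrightarrow> smooth_fun \<A> f \<Longrightarrow>
    D v X (\<lambda>p. f p *\<^sub>R Y p) = deriv_along \<A> (fst v) (X (fst v)) f *\<^sub>R Y (fst v) + f (fst v) *\<^sub>R D v X Y"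
  using conn by (simp add: aniso_connection_def)

lemma conn_linear:
  "v \<in> A \<Longrightarrow> X \<in> vfields \<A> \<Longrightarrow> Y \<in> vfields \<A> \<Longrightarrow> Z \<in> vfields \<A> \<Longrightarrow> smooth_fun \<A> f \<Longrightarrow> smooth_fun \<A> h \<Longrightarrow>
    D v (\<lambda>p. f p *\<^sub>R X p + h p *\<^sub>R Y p) Z = f (fst v) *\<^sub>R D v X Z + h (fst v) *\<^sub>R D v Y Z"
  using conn by (simp add: aniso_connection_def)

lemma conn_scale_left:
  "v \<in> A \<Longrightarrow> X \<in> vfields \<A> \<Longrightarrow> Z \<in> vfields \<A> \<Longrightarrow> smooth_fun \<A> f \<Longrightarrow>
    D v (\<lambda>p. f p *\<^sub>R X p) Z = f (fst v) *\<^sub>R D v X Z"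
  using conn_linear[of v X X Z f "\<lambda>p. 0"] smooth_fun_const by simp

lemma conn_sum_left:
  assumes v: "v \<in> A" and Z: "Z \<in> vfields \<A>" and "finite I"
    and X: "\<And>i. X i \<in> vfields \<A>" and f: "\<And>i. smooth_fun \<A> (f i)"
  shows "D v (\<lambda>p. \<Sum>i\<in>I. f i p *\<^sub>R X i p) Z = (\<Sum>i\<in>I. f i (fst v) *\<^sub>R D v (X i) Z)"
  using \<open>finite I\<close>
proof induction
  case empty
  then show ?case
    using conn_scale_left[OF v vfields_zero Z smooth_fun_const[of 0]] by simp
next
  case (insert i I)
  have "D v (\<lambda>p. f i p *\<^sub>R X i p + 1 *\<^sub>R (\<Sum>i\<in>I. f i p *\<^sub>R X i p)) Z
      = f i (fst v) *\<^sub>R D v (X i) Z + 1 *\<^sub>R D v (\<lambda>p. \<Sum>i\<in>I. f i p *\<^sub>R X i p) Z"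
    by (intro conn_linear v X Z f smooth_fun_const vfields_sum vfields_scale)
  then show ?case using insert by simp
qed

lemma conn_sum_right:
  assumes v: "v \<in> A" and X: "X \<in> vfields \<A>" and "finite I"
    and Y: "\<And>i. Y i \<in> vfields \<A>" and f: "\<And>i. smooth_fun \<A> (f i)"
  shows "D v X (\<lambda>p. \<Sum>i\<in>I. f i p *\<^sub>R Y i p) =
    (\<Sum>i\<in>I. deriv_along \<A> (fst v) (X (fst v)) (f i) *\<^sub>R Y i (fst v) + f i (fst v) *\<^sub>R D v X (Y i))"
  using \<open>finite I\<close>
proof induction
  case empty
  then show ?case
    using conn_add[OF v X vfields_zero vfields_zero] by simp
next
  case (insert i I)
  have "D v X (\<lambda>p. f i p *\<^sub>R Y i p + (\<Sum>i\<in>I. f i p *\<^sub>R Y i p))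
      = D v X (\<lambda>p. f i p *\<^sub>R Y i p) + D v X (\<lambda>p. \<Sum>i\<in>I. f i p *\<^sub>R Y i p)"
    by (intro conn_add v X Y f vfields_sum vfields_scale)
  then show ?case using insert by (simp add: conn_leibniz[OF v X Y f])
qed

text \<open>The components of \<open>X\<close> are only defined on the chart, so not
  \<open>X\<close> but its product with \<open>\<rho>\<close> is expanded: the cut-off components
  are global smooth functions, as the rules for the connection require.\<close>

lemma frame_expansion:
  assumes F: "frame c E U" and b: "bump U q \<rho> C N" and X: "X \<in> vfields \<A>"
  obtains f where "\<And>b. smooth_fun \<A> (f b)" "\<And>p b. p \<in> N \<Longrightarrow> f b p = coords (X p) c \<bullet> b"
    "(\<lambda>p. \<rho> p *\<^sub>R X p) = (\<lambda>p. \<Sum>b\<in>Basis. f b p *\<^sub>R E b p)"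
proof
  note F' = frameD[OF F]
  define f where "f b p = \<rho> p * (if p \<in> U then coords (X p) c \<bullet> b else 0)" for b p
  have N: "N \<subseteq> C" "C \<subseteq> U" "\<And>p. p \<in> N \<Longrightarrow> \<rho> p = 1" "\<And>p. p \<notin> C \<Longrightarrow> \<rho> p = 0"
    using b by (auto simp: bump_def)
  have "open (cmap c ` U)" using open_chart_image[OF F'(1,2)] F'(3) by (metis Int_absorb1)
  then show "smooth_fun \<A> (f b)" for b
    unfolding f_def
    using smooth_on_inner_const[OF _ smooth_on_subset[OF vfields_smooth_UNIV[OF X F'(1)]], of "cmap c ` U"] F'(3)
    by (intro bump_extend_fun[OF b F'(2,1,3)]) (auto simp: o_def)
  show "f b p = coords (X p) c \<bullet> b" if "p \<in> N" for b p
    using that N by (auto simp: f_def)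
  show "(\<lambda>p. \<rho> p *\<^sub>R X p) = (\<lambda>p. \<Sum>b\<in>Basis. f b p *\<^sub>R E b p)"
  proof
    fix p
    show "\<rho> p *\<^sub>R X p = (\<Sum>b\<in>Basis. f b p *\<^sub>R E b p)"
    proof (cases "p \<in> U")
      case True
      show ?thesis
      proof (rule tangent_eqI[OF _ _ F'(1)])
        show "\<rho> p *\<^sub>R X p \<in> T p"
          by (intro subspace_scale subspace_tangent vfields_tangent[OF X]) simp
        show "(\<Sum>b\<in>Basis. f b p *\<^sub>R E b p) \<in> T p"
          by (intro subspace_sum subspace_scale subspace_tangent vfields_tangent[OF F'(4)]) simp
        have "(\<Sum>b\<in>Basis. f b p *\<^sub>R b) = \<rho> p *\<^sub>R (\<Sum>b\<in>Basis. (coords (X p) c \<bullet> b) *\<^sub>R b)"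
          using True by (simp add: f_def scaleR_sum_right)
        then show "coords (\<rho> p *\<^sub>R X p) c = coords (\<Sum>b\<in>Basis. f b p *\<^sub>R E b p) c"
          using True F'(5) by (simp add: euclidean_representation)
      qed (use True F' in blast)
    next
      case False
      then show ?thesis using N by (auto simp: f_def)
    qed
  qed
qed

abbreviation \<Gamma> where "\<Gamma> \<equiv> christoffel D"

text \<open>Multiplying \<open>X\<close> and \<open>Y\<close> by \<open>\<rho>\<close> does not
  change the value at \<open>v\<close>, and the products are global combinations of the frame.
  Linearity in the first argument and the Leibniz rule in the second then leave the derivatives of
  the components of \<open>Y\<close> and the values on the frame.\<close>

lemma conn_coords:
  assumes F: "frame c E U" and v: "v \<in> A" "fst v \<in> U" and X: "X \<in> vfields \<A>" and Y: "Y \<in> vfields \<A>"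
  shows "coords (D v X Y) c = FD (field_coords c Y) (cmap c (fst v)) (coords (X (fst v)) c)
    + \<Gamma> c E (tmap c v) (coords (X (fst v)) c) (coords (Y (fst v)) c)"
proof -
  note F' = frameD[OF F]
  let ?q = "fst v" and ?x = "cmap c (fst v)"
  have q: "?q \<in> cdom c" using v F' by blast
  obtain \<rho> C N where b: "bump U ?q \<rho> C N" using bump_exists[OF F'(2) v(2)] by blast
  have N: "open N" "?q \<in> N" "N \<subseteq> U" "\<And>p. p \<in> N \<Longrightarrow> \<rho> p = 1" and \<rho>: "smooth_fun \<A> \<rho>"
    using b by (auto simp: bump_def)
  have oN: "open (cmap c ` (cdom c \<inter> N))" "?x \<in> cmap c ` (cdom c \<inter> N)"
    using open_chart_image[OF F'(1) N(1)] q N by auto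
  have diffY: "field_coords c Y differentiable at ?x"
    using smooth_on_differentiable[OF vfields_smooth_UNIV[OF Y F'(1)]] q by blast
  \<comment> \<open>\<open>\<rho>\<close> is constantly 1 near the point, so the derivative term in
    the Leibniz rule for its product with \<open>Y\<close> is zero.\<close>
  have "FD (\<rho> \<circ> cinv c) ?x = FD (\<lambda>x. 1) ?x"
    by (rule FD_cong_open(2)[OF oN]) (use F'(1) N in \<open>auto simp: cinv_cmap\<close>)
  then have d\<rho>: "deriv_along \<A> ?q (X ?q) \<rho> = 0"
    using deriv_along_chart[OF \<rho> vfields_tangent[OF X] F'(1) q] by simp
  obtain f where f: "\<And>b. smooth_fun \<A> (f b)" "\<And>p b. p \<in> N \<Longrightarrow> f b p = coords (X p) c \<bullet> b"
    "(\<lambda>p. \<rho> p *\<^sub>R X p) = (\<lambda>p. \<Sum>b\<in>Basis. f b p *\<^sub>R E b p)" by (rule frame_expansion[OF F b X]) (rule that)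
  obtain g where g: "\<And>b. smooth_fun \<A> (g b)" "\<And>p b. p \<in> N \<Longrightarrow> g b p = coords (Y p) c \<bullet> b"
    "(\<lambda>p. \<rho> p *\<^sub>R Y p) = (\<lambda>p. \<Sum>b\<in>Basis. g b p *\<^sub>R E b p)" by (rule frame_expansion[OF F b Y]) (rule that)
  have dX: "D v X Z = (\<Sum>i\<in>Basis. (coords (X ?q) c \<bullet> i) *\<^sub>R D v (E i) Z)" if Z: "Z \<in> vfields \<A>" for Z
  proof -
    have "D v X Z = D v (\<lambda>p. \<rho> p *\<^sub>R X p) Z"
      using N by (simp add: conn_scale_left[OF v(1) X Z \<rho>])
    also have "\<dots> = (\<Sum>i\<in>Basis. f i ?q *\<^sub>R D v (E i) Z)"
      unfolding f(3) by (rule conn_sum_left[OF v(1) Z _ F'(4) f(1)]) simp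
    finally show ?thesis using f(2)[OF N(2)] by simp
  qed
  have dg: "deriv_along \<A> ?q (X ?q) (g j) = FD (field_coords c Y) ?x (coords (X ?q) c) \<bullet> j" for j
  proof -
    have "FD (g j \<circ> cinv c) ?x = FD (\<lambda>x. field_coords c Y x \<bullet> j) ?x"
      by (rule FD_cong_open(2)[OF oN]) (use F'(1) g(2) in \<open>auto simp: cinv_cmap\<close>)
    also have "\<dots> = (\<lambda>h. FD (field_coords c Y) ?x h \<bullet> j)"
      by (intro FD_eq has_derivative_inner_left FD_works diffY)
    finally show ?thesis
      using deriv_along_chart[OF g(1) vfields_tangent[OF X] F'(1) q] by simp
  qed
  have "D v X Y = D v X (\<lambda>p. \<rho> p *\<^sub>R Y p)"
    using N d\<rho> by (simp add: conn_leibniz[OF v(1) X Y \<rho>])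
  also have "\<dots> = (\<Sum>j\<in>Basis. deriv_along \<A> ?q (X ?q) (g j) *\<^sub>R E j ?q + g j ?q *\<^sub>R D v X (E j))"
    unfolding g(3) by (rule conn_sum_right[OF v(1) X _ F'(4) g(1)]) simp
  also have "\<dots> = (\<Sum>j\<in>Basis. (FD (field_coords c Y) ?x (coords (X ?q) c) \<bullet> j) *\<^sub>R E j ?q
      + (coords (Y ?q) c \<bullet> j) *\<^sub>R (\<Sum>i\<in>Basis. (coords (X ?q) c \<bullet> i) *\<^sub>R D v (E i) (E j)))"
    using g(2)[OF N(2)] by (simp add: dg dX[OF F'(4)])
  finally show ?thesis
    by (simp add: christoffel_def tinv_tmap[OF F'(1) v(1) q] F'(5)[OF v(2)] sum.distrib euclidean_representation)
qed

text \<open>Locality is not an axiom; it is read off \<open>conn_coords\<close>, where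
  \<open>Y\<close> enters through its value and first derivative at the base point.\<close>

lemma conn_cong:
  assumes v: "v \<in> A" and X: "X \<in> vfields \<A>" and Y: "Y \<in> vfields \<A>" "Z \<in> vfields \<A>"
    and eq: "\<forall>\<^sub>F p in nhds (fst v). Y p = Z p"
  shows "D v X Y = D v X Z"
proof -
  obtain c E U where F: "frame c E U" "fst v \<in> U" by (rule frame_exists)
  note F' = frameD[OF F(1)]
  obtain N where N: "open N" "fst v \<in> N" "\<And>p. p \<in> N \<Longrightarrow> Y p = Z p"
    using eq by (auto simp: eventually_nhds)
  have "FD (field_coords c Y) (cmap c (fst v)) = FD (field_coords c Z) (cmap c (fst v))"
    by (rule FD_cong_open(2)[OF open_chart_image[OF F'(1) N(1)]])
      (use F F' N in \<open>auto simp: cinv_cmap\<close>)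
  then have "coords (D v X Y) c = coords (D v X Z) c"
    using conn_coords[OF F(1) v F(2) X] Y N by simp
  then show ?thesis
    using tangent_eqI[OF conn_tangent[OF v X Y(1)] conn_tangent[OF v X Y(2)] F'(1)] F F' by blast
qed

text \<open>The description in \<open>conn_local\<close> is proper: a global field with the germ of
  \<open>W\<close> exists by \<open>local_field_extend\<close>, and \<open>conn_cong\<close> makes
  all of them give one value.\<close>

lemma conn_local_coords:
  assumes F: "frame c E U" and v: "v \<in> A" "fst v \<in> U" and X: "X \<in> vfields \<A>"
    and \<Omega>: "open \<Omega>" "fst v \<in> \<Omega>" and W: "W \<in> vfields_on \<A> \<Omega>"
  shows "conn_local \<A> D v X W \<in> T (fst v)"
    and "coords (conn_local \<A> D v X W) c = FD (field_coords c W) (cmap c (fst v)) (coords (X (fst v)) c)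
      + \<Gamma> c E (tmap c v) (coords (X (fst v)) c) (coords (W (fst v)) c)"
proof -
  note F' = frameD[OF F]
  obtain W' N where W': "W' \<in> vfields \<A>" and N: "open N" "fst v \<in> N" "N \<subseteq> \<Omega>" "\<And>q. q \<in> N \<Longrightarrow> W' q = W q"
    using local_field_extend[OF \<Omega> W] by metis
  have ev: "\<forall>\<^sub>F p in nhds (fst v). W' p = W p" using N by (auto simp: eventually_nhds)
  have e: "conn_local \<A> D v X W = D v X W'"
    unfolding conn_local_def
  proof (rule the_equality)
    show "\<forall>W''\<in>vfields \<A>. (\<forall>\<^sub>F p in nhds (fst v). W'' p = W p) \<longrightarrow> D v X W' = D v X W''"
    proof (intro ballI impI)
      fix W'' assume "W'' \<in> vfields \<A>" "\<forall>\<^sub>F p in nhds (fst v). W'' p = W p"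
      moreover from this(2) ev have "\<forall>\<^sub>F p in nhds (fst v). W' p = W'' p" by eventually_elim simp
      ultimately show "D v X W' = D v X W''" using conn_cong[OF v(1) X W'] by blast
    qed
  qed (use W' ev in blast)
  have "FD (field_coords c W') (cmap c (fst v)) = FD (field_coords c W) (cmap c (fst v))"
    by (rule FD_cong_open(2)[OF open_chart_image[OF F'(1) N(1)]])
      (use v F' N in \<open>auto simp: cinv_cmap\<close>)
  then show "coords (conn_local \<A> D v X W) c = FD (field_coords c W) (cmap c (fst v)) (coords (X (fst v)) c)
      + \<Gamma> c E (tmap c v) (coords (X (fst v)) c) (coords (W (fst v)) c)"
    using conn_coords[OF F v X W'] N by (simp add: e)
  show "conn_local \<A> D v X W \<in> T (fst v)" using conn_tangent[OF v(1) X W'] by (simp add: e)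
qed

text \<open>The derivative of \<open>\<Y>\<close> is taken along the horizontal lift of \<open>X\<close>, in which the derivatives
  of the extension of \<open>v\<close> have cancelled.\<close>

lemma conn_aniso_coords:
  assumes F: "frame c E U" and v: "v \<in> A" "fst v \<in> U" and X: "X \<in> vfields \<A>"
    and Y: "\<Y> \<in> aniso_fields \<A> A"
    and G: "(G has_derivative G') (at (tmap c v))"
    and YG: "\<And>v'. v' \<in> A \<Longrightarrow> fst v' \<in> U \<Longrightarrow> coords (\<Y> v') c = G (tmap c v')"
    and x: "x = coords (X (fst v)) c"
  shows "conn_aniso \<A> A D v X \<Y> \<in> T (fst v)"
    and "coords (conn_aniso \<A> A D v X \<Y>) c
      = G' (x, - \<Gamma> c E (tmap c v) x (coords (snd v) c)) + \<Gamma> c E (tmap c v) x (coords (\<Y> v) c)"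
proof -
  note F' = frameD[OF F]
  have q: "fst v \<in> cdom c" using v F' by blast
  \<comment> \<open>The candidate for the described value. It does not mention the extension
    \<open>V\<close>, so matching it for every \<open>V\<close> gives uniqueness and independence at
    once.\<close>
  define r where "r = tvec_of c (fst v)
    (G' (x, - \<Gamma> c E (tmap c v) x (coords (snd v) c)) + \<Gamma> c E (tmap c v) x (coords (\<Y> v) c))"
  have rT: "r \<in> T (fst v)" unfolding r_def by (rule tvec_of_tangent[OF F'(1) q])
  have rc: "coords r c = G' (x, - \<Gamma> c E (tmap c v) x (coords (snd v) c)) + \<Gamma> c E (tmap c v) x (coords (\<Y> v) c)"
    unfolding r_def by (rule coords_tvec_of[OF F'(1) q])
  have all: "r = conn_local \<A> D v X (\<lambda>p. \<Y> (p, V p)) - vertical_deriv \<Y> v (conn_local \<A> D v X V)"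
    if V: "admissible_on \<A> A \<Omega> V" and p: "fst v \<in> \<Omega>" "V (fst v) = snd v" for \<Omega> V
  proof -
    have V': "open \<Omega>" "V \<in> vfields_on \<A> \<Omega>" "\<And>p. p \<in> \<Omega> \<Longrightarrow> (p, V p) \<in> A"
      using V by (auto simp: admissible_on_def)
    note YV = aniso_along_field[OF Y V]
    note lV = conn_local_coords[OF F v X V'(1) p(1) V'(2)]
    note lY = conn_local_coords[OF F v X V'(1) p(1) YV(1)]
    have Yv: "\<Y> (fst v, V (fst v)) = \<Y> v" using p(2) by simp
    note vd = vertical_deriv_coords[OF v(1) lV(1) F'(1) q _ G, of \<Y>]
    have vd1: "vertical_deriv \<Y> v (conn_local \<A> D v X V) \<in> T (fst v)"
      and vd2: "coords (vertical_deriv \<Y> v (conn_local \<A> D v X V)) c = G' (0, coords (conn_local \<A> D v X V) c)"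
      using vd aniso_fields_tangent[OF Y] YG v(2) by metis+
    let ?S = "cmap c ` (cdom c \<inter> (U \<inter> \<Omega>))"
    have S: "open ?S" "cmap c (fst v) \<in> ?S"
      using open_chart_image[OF F'(1) open_Int[OF F'(2) V'(1)]] q v(2) p(1) by auto
    have dV: "(field_coords c V has_derivative FD (field_coords c V) (cmap c (fst v))) (at (cmap c (fst v)))"
      by (rule FD_works[OF smooth_on_differentiable[OF vfields_smooth[OF V'(2) F'(1)]]]) (use q p in blast)
    have Vx: "field_coords c V (cmap c (fst v)) = coords (snd v) c" using cinv_cmap[OF F'(1) q] p(2) by simp
    have "((\<lambda>x. G (x, field_coords c V x)) has_derivative
        (\<lambda>h. G' (h, FD (field_coords c V) (cmap c (fst v)) h))) (at (cmap c (fst v)))"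
      by (rule has_derivative_compose[where f = "\<lambda>x. (x, field_coords c V x)"])
        (auto intro!: has_derivative_Pair has_derivative_ident dV G[unfolded tmap_def] simp: Vx)
    then have "(field_coords c (\<lambda>p. \<Y> (p, V p)) has_derivative
        (\<lambda>h. G' (h, FD (field_coords c V) (cmap c (fst v)) h))) (at (cmap c (fst v)))"
    proof (rule has_derivative_transform_within_open[OF _ S])
      fix x assume "x \<in> ?S"
      then obtain p where p: "p \<in> cdom c" "p \<in> U" "p \<in> \<Omega>" "x = cmap c p" by blast
      then show "G (x, field_coords c V x) = field_coords c (\<lambda>p. \<Y> (p, V p)) x"
        using YG[OF V'(3)[OF p(3)]] by (simp add: cinv_cmap F'(1) tmap_def)
    qed
    then have "FD (field_coords c (\<lambda>p. \<Y> (p, V p))) (cmap c (fst v)) x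
        = G' (x, FD (field_coords c V) (cmap c (fst v)) x)" by (simp add: FD_eq)
    \<comment> \<open>The linear map \<open>G'\<close> turns the difference of the two terms into
      one value at the difference of the vectors, where the derivative of \<open>V\<close> occurs
      twice with opposite signs.\<close>
    moreover have "G' (x, FD (field_coords c V) (cmap c (fst v)) x)
        - G' (0, FD (field_coords c V) (cmap c (fst v)) x + \<Gamma> c E (tmap c v) x (coords (snd v) c))
        = G' (x, - \<Gamma> c E (tmap c v) x (coords (snd v) c))"
      using linear_diff[OF has_derivative_linear[OF G], symmetric] by simp
    ultimately have "coords r c = coords (conn_local \<A> D v X (\<lambda>p. \<Y> (p, V p))
        - vertical_deriv \<Y> v (conn_local \<A> D v X V)) c"
      using lY(2) by (simp add: rc vd2 lV(2) Yv x[symmetric] p(2))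
    then show ?thesis
      by (intro tangent_eqI[OF rT _ F'(1) q] subspace_diff[OF subspace_tangent] lY(1) vd1)
  qed
  obtain \<Omega> V where V: "admissible_on \<A> A \<Omega> V" "fst v \<in> \<Omega>" "V (fst v) = snd v"
    by (rule admissible_extension[OF v(1)])
  have "conn_aniso \<A> A D v X \<Y> = r"
    unfolding conn_aniso_def by (rule the_equality) (use all V in metis)+
  then show "conn_aniso \<A> A D v X \<Y> \<in> T (fst v)" "coords (conn_aniso \<A> A D v X \<Y>) c
      = G' (x, - \<Gamma> c E (tmap c v) x (coords (snd v) c)) + \<Gamma> c E (tmap c v) x (coords (\<Y> v) c)"
    using rT rc by simp_all
qed

end

section \<open>Tensors in coordinates\<close>

context smooth_manifold
begin

text \<open>A criterion for tensoriality: if the coordinates of \<open>B X Y\<close> are the same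
  \<open>k\<close> for all fields with the given values at \<open>p\<close>, then
  \<open>tvec_of c p k\<close> is the described value.\<close>

lemma on_vectors2_coords:
  assumes c: "c \<in> \<A>" "p \<in> cdom c" and xy: "x \<in> T p" "y \<in> T p"
    and B: "\<And>X Y. X \<in> vfields \<A> \<Longrightarrow> Y \<in> vfields \<A> \<Longrightarrow> X p = x \<Longrightarrow> Y p = y \<Longrightarrow>
      B X Y \<in> T p \<and> coords (B X Y) c = k"
  shows "on_vectors2 \<A> p B x y \<in> T p" "coords (on_vectors2 \<A> p B x y) c = k"
proof -
  have k: "tvec_of c p k \<in> T p" "coords (tvec_of c p k) c = k"
    using tvec_of_tangent[OF c] coords_tvec_of[OF c] by auto
  obtain X Y where XY: "X \<in> vfields \<A>" "Y \<in> vfields \<A>" "X p = x" "Y p = y"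
    using tangent_extend xy by metis
  have "\<And>X Y. X \<in> vfields \<A> \<Longrightarrow> Y \<in> vfields \<A> \<Longrightarrow> X p = x \<Longrightarrow> Y p = y \<Longrightarrow> tvec_of c p k = B X Y"
    using tangent_eqI[OF k(1) _ c] B k(2) by metis
  then have "on_vectors2 \<A> p B x y = tvec_of c p k"
    unfolding on_vectors2_def using XY by (intro the_equality) metis+
  then show "on_vectors2 \<A> p B x y \<in> T p" "coords (on_vectors2 \<A> p B x y) c = k" using k by simp_all
qed

lemma on_vectors3_coords:
  assumes c: "c \<in> \<A>" "p \<in> cdom c" and xyz: "x \<in> T p" "y \<in> T p" "z \<in> T p"
    and B: "\<And>X Y Z. X \<in> vfields \<A> \<Longrightarrow> Y \<in> vfields \<A> \<Longrightarrow> Z \<in> vfields \<A> \<Longrightarrow> X p = x \<Longrightarrow> Y p = y \<Longrightarrow> Z p = z \<Longrightarrow>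
      B X Y Z \<in> T p \<and> coords (B X Y Z) c = k"
  shows "on_vectors3 \<A> p B x y z \<in> T p" "coords (on_vectors3 \<A> p B x y z) c = k"
proof -
  have k: "tvec_of c p k \<in> T p" "coords (tvec_of c p k) c = k"
    using tvec_of_tangent[OF c] coords_tvec_of[OF c] by auto
  obtain X Y Z where XYZ: "X \<in> vfields \<A>" "Y \<in> vfields \<A>" "Z \<in> vfields \<A>" "X p = x" "Y p = y" "Z p = z"
    using tangent_extend xyz by metis
  have "\<And>X Y Z. X \<in> vfields \<A> \<Longrightarrow> Y \<in> vfields \<A> \<Longrightarrow> Z \<in> vfields \<A> \<Longrightarrow> X p = x \<Longrightarrow> Y p = y \<Longrightarrow> Z p = z \<Longrightarrow>
      tvec_of c p k = B X Y Z"
    using tangent_eqI[OF k(1) _ c] B k(2) by metis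
  then have "on_vectors3 \<A> p B x y z = tvec_of c p k"
    unfolding on_vectors3_def using XYZ by (intro the_equality) metis+
  then show "on_vectors3 \<A> p B x y z \<in> T p" "coords (on_vectors3 \<A> p B x y z) c = k" using k by simp_all
qed

end

context aniso_domain
begin

lemma vfield_has_derivative:
  assumes "X \<in> vfields \<A>" "c \<in> \<A>" "p \<in> cdom c"
  shows "(field_coords c X has_derivative FD (field_coords c X) (cmap c p)) (at (cmap c p))"
  using FD_works[OF smooth_on_differentiable[OF vfields_smooth_UNIV[OF assms(1,2)]]] assms(3) by blast

lemma vfield_has_derivative_lifted:
  assumes X: "X \<in> vfields \<A>" and c: "c \<in> \<A>" "fst v \<in> cdom c"
  shows "((\<lambda>\<zeta>. field_coords c X (fst \<zeta>)) has_derivative (\<lambda>h. FD (field_coords c X) (cmap c (fst v)) (fst h)))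
    (at (tmap c v))"
  by (rule has_derivative_compose[OF has_derivative_fst[OF has_derivative_ident]])
    (use vfield_has_derivative[OF X c] in \<open>simp add: tmap_def\<close>)

end

context aniso_conn
begin

section \<open>Torsion, vertical derivative and curvature through Christoffel symbols\<close>

lemma christoffel_smooth:
  assumes "frame c E U"
  shows "smooth_on (over c (cdom c)) (\<lambda>\<zeta>. \<Gamma> c E \<zeta> a b)"
  unfolding christoffel_def using frameD[OF assms]
  by (intro smooth_on_sum smooth_on_scaleR smooth_on_const open_over open_cdom subset_refl
      aniso_fields_smooth conn_aniso_field) auto

lemma christoffel_differentiable:
  assumes F: "frame c E U" and v: "v \<in> A" "fst v \<in> U"
  shows "(\<lambda>\<zeta>. \<Gamma> c E \<zeta> a b) differentiable at (tmap c v)"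
  by (rule smooth_on_differentiable[OF christoffel_smooth[OF F]]) (use frameD(3)[OF F] v in \<open>auto simp: over_def\<close>)

lemma christoffel_fields_has_derivative:
  assumes F: "frame c E U" and v: "v \<in> A" "fst v \<in> U" and X: "X \<in> vfields \<A>" and Y: "Y \<in> vfields \<A>"
  shows "((\<lambda>\<zeta>. \<Gamma> c E \<zeta> (field_coords c X (fst \<zeta>)) (field_coords c Y (fst \<zeta>))) has_derivative
    (\<lambda>h. FD (\<lambda>\<zeta>. \<Gamma> c E \<zeta> (coords (X (fst v)) c) (coords (Y (fst v)) c)) (tmap c v) h
      + \<Gamma> c E (tmap c v) (FD (field_coords c X) (cmap c (fst v)) (fst h)) (coords (Y (fst v)) c)
      + \<Gamma> c E (tmap c v) (coords (X (fst v)) c) (FD (field_coords c Y) (cmap c (fst v)) (fst h))))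
    (at (tmap c v))"
proof -
  note F' = frameD[OF F]
  have q: "fst v \<in> cdom c" using F' v by blast
  have e: "field_coords c Z (fst (tmap c v)) = coords (Z (fst v)) c" for Z
    by (simp add: tmap_def cinv_cmap[OF F'(1) q])
  show ?thesis
    using has_derivative_bilinear_family[OF open_UNIV UNIV_I linear_christoffel_left linear_christoffel_right
        christoffel_differentiable[OF F v] vfield_has_derivative_lifted[OF X F'(1) q]
        vfield_has_derivative_lifted[OF Y F'(1) q]]
    unfolding e .
qed

text \<open>The terms with derivatives of the fields, once antisymmetrized, are the coordinates of
  the Lie bracket.\<close>

lemma torsion_coords:
  assumes F: "frame c E U" and v: "v \<in> A" "fst v \<in> U" and xy: "x \<in> T (fst v)" "y \<in> T (fst v)"
  shows "torsion \<A> D v x y \<in> T (fst v)"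
    and "coords (torsion \<A> D v x y) c
      = \<Gamma> c E (tmap c v) (coords x c) (coords y c) - \<Gamma> c E (tmap c v) (coords y c) (coords x c)"
proof -
  note F' = frameD[OF F]
  have q: "fst v \<in> cdom c" using F' v by blast
  have "D v X Y - D v Y X - lie_bracket \<A> X Y (fst v) \<in> T (fst v) \<and>
    coords (D v X Y - D v Y X - lie_bracket \<A> X Y (fst v)) c
      = \<Gamma> c E (tmap c v) (coords x c) (coords y c) - \<Gamma> c E (tmap c v) (coords y c) (coords x c)"
    if X: "X \<in> vfields \<A>" and Y: "Y \<in> vfields \<A>" and e: "X (fst v) = x" "Y (fst v) = y" for X Y
  proof
    show "D v X Y - D v Y X - lie_bracket \<A> X Y (fst v) \<in> T (fst v)"
      by (intro subspace_diff subspace_tangent conn_tangent v X Y vfields_tangent[OF lie_bracket_vfields]) simp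
  qed (simp add: conn_coords[OF F v X Y] conn_coords[OF F v Y X] coords_lie_bracket[OF F'(1) q] e)
  note * = on_vectors2_coords[OF F'(1) q xy this]
  show "torsion \<A> D v x y \<in> T (fst v)"
    unfolding torsion_def by (rule *(1))
  show "coords (torsion \<A> D v x y) c
      = \<Gamma> c E (tmap c v) (coords x c) (coords y c) - \<Gamma> c E (tmap c v) (coords y c) (coords x c)"
    unfolding torsion_def by (rule *(2))
qed

lemma conn_vertical_deriv_coords:
  assumes F: "frame c E U" and v: "v \<in> A" "fst v \<in> U"
    and xyz: "x \<in> T (fst v)" "y \<in> T (fst v)" "z \<in> T (fst v)"
  shows "conn_vertical_deriv \<A> D v x y z \<in> T (fst v)"
    and "coords (conn_vertical_deriv \<A> D v x y z) c
      = FD (\<lambda>\<zeta>. \<Gamma> c E \<zeta> (coords x c) (coords y c)) (tmap c v) (0, coords z c)"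
proof -
  note F' = frameD[OF F]
  have q: "fst v \<in> cdom c" using F' v by blast
  have "vertical_deriv (\<lambda>v'. D v' X Y) v z \<in> T (fst v) \<and>
    coords (vertical_deriv (\<lambda>v'. D v' X Y) v z) c
      = FD (\<lambda>\<zeta>. \<Gamma> c E \<zeta> (coords x c) (coords y c)) (tmap c v) (0, coords z c)"
    if X: "X \<in> vfields \<A>" and Y: "Y \<in> vfields \<A>" and e: "X (fst v) = x" "Y (fst v) = y" for X Y
  proof -
    \<comment> \<open>The part of the connection that differentiates \<open>Y\<close>. It depends on
      the base point only, so it is constant along the fibre and has no vertical derivative.\<close>
    define k where "k = FD (field_coords c Y) (cmap c (fst v)) (coords x c)"
    have G: "((\<lambda>\<zeta>. k + \<Gamma> c E \<zeta> (coords x c) (coords y c)) has_derivative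
        (\<lambda>h. 0 + FD (\<lambda>\<zeta>. \<Gamma> c E \<zeta> (coords x c) (coords y c)) (tmap c v) h)) (at (tmap c v))"
      by (intro has_derivative_add has_derivative_const FD_works christoffel_differentiable[OF F v])
    have t: "D v' X Y \<in> T (fst v)" if "v' \<in> A" "fst v' = fst v" for v'
      using conn_tangent[OF that(1) X Y] that(2) by simp
    have c: "coords (D v' X Y) c = k + \<Gamma> c E (tmap c v') (coords x c) (coords y c)" if "v' \<in> A" "fst v' = fst v" for v'
      using conn_coords[OF F that(1) _ X Y] that(2) v(2) e by (simp add: k_def)
    have "vertical_deriv (\<lambda>v'. D v' X Y) v z \<in> T (fst v)"
      by (rule vertical_deriv_coords(1)[OF v(1) xyz(3) F'(1) q t G c])
    moreover have "coords (vertical_deriv (\<lambda>v'. D v' X Y) v z) c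
        = 0 + FD (\<lambda>\<zeta>. \<Gamma> c E \<zeta> (coords x c) (coords y c)) (tmap c v) (0, coords z c)"
      by (rule vertical_deriv_coords(2)[OF v(1) xyz(3) F'(1) q t G c])
    ultimately show ?thesis by simp
  qed
  note * = on_vectors2_coords[OF F'(1) q xyz(1,2) this]
  show "conn_vertical_deriv \<A> D v x y z \<in> T (fst v)"
    unfolding conn_vertical_deriv_def by (rule *(1))
  show "coords (conn_vertical_deriv \<A> D v x y z) c
      = FD (\<lambda>\<zeta>. \<Gamma> c E \<zeta> (coords x c) (coords y c)) (tmap c v) (0, coords z c)"
    unfolding conn_vertical_deriv_def by (rule *(2))
qed

text \<open>A field pulled back from the base is constant on fibres, so the vertical part of the
  horizontal lift contributes nothing and the formula of \<open>conn_coords\<close>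
  reappears.\<close>

lemma conn_aniso_vfield_coords:
  assumes F: "frame c E U" and v: "v \<in> A" "fst v \<in> U" and X: "X \<in> vfields \<A>" and Y: "Y \<in> vfields \<A>"
  shows "conn_aniso \<A> A D v X (\<lambda>v'. Y (fst v')) \<in> T (fst v)"
    and "coords (conn_aniso \<A> A D v X (\<lambda>v'. Y (fst v'))) c
      = FD (field_coords c Y) (cmap c (fst v)) (coords (X (fst v)) c)
        + \<Gamma> c E (tmap c v) (coords (X (fst v)) c) (coords (Y (fst v)) c)"
proof -
  note F' = frameD[OF F]
  have qc: "fst v \<in> cdom c" using F' v by blast
  have YG: "coords (Y (fst v')) c = field_coords c Y (fst (tmap c v'))" if "v' \<in> A" "fst v' \<in> U" for v'
    using cinv_cmap[OF F'(1), of "fst v'"] F'(3) that(2) by (auto simp: tmap_def)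
  note * = conn_aniso_coords[OF F v X vfield_aniso[OF Y] vfield_has_derivative_lifted[OF Y F'(1) qc] YG refl]
  show "conn_aniso \<A> A D v X (\<lambda>v'. Y (fst v')) \<in> T (fst v)" by (rule *(1))
  show "coords (conn_aniso \<A> A D v X (\<lambda>v'. Y (fst v'))) c
      = FD (field_coords c Y) (cmap c (fst v)) (coords (X (fst v)) c)
        + \<Gamma> c E (tmap c v) (coords (X (fst v)) c) (coords (Y (fst v)) c)"
    by (rule trans[OF *(2)], assumption, assumption, simp)
qed

text \<open>The derivative at \<open>v\<close> along the horizontal lift of \<open>x\<close>.\<close>

abbreviation horizontal_deriv ("\<delta>") where
  "\<delta> c E v f x \<equiv> FD f (tmap c v) (x, - \<Gamma> c E (tmap c v) x (coords (snd v) c))"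

lemma conn_aniso_conn_coords:
  assumes F: "frame c E U" and v: "v \<in> A" "fst v \<in> U"
    and X: "X \<in> vfields \<A>" and Y: "Y \<in> vfields \<A>" and Z: "Z \<in> vfields \<A>"
    and xyz: "x = coords (X (fst v)) c" "y = coords (Y (fst v)) c" "z = coords (Z (fst v)) c"
  shows "conn_aniso \<A> A D v X (\<lambda>v'. D v' Y Z) \<in> T (fst v)"
    and "coords (conn_aniso \<A> A D v X (\<lambda>v'. D v' Y Z)) c =
      D2 (field_coords c Z) (cmap c (fst v)) x y
      + FD (field_coords c Z) (cmap c (fst v)) (FD (field_coords c Y) (cmap c (fst v)) x)
      + \<Gamma> c E (tmap c v) (FD (field_coords c Y) (cmap c (fst v)) x) z
      + \<Gamma> c E (tmap c v) y (FD (field_coords c Z) (cmap c (fst v)) x)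
      + \<Gamma> c E (tmap c v) x (FD (field_coords c Z) (cmap c (fst v)) y)
      + \<delta> c E v (\<lambda>\<zeta>. \<Gamma> c E \<zeta> y z) x + \<Gamma> c E (tmap c v) x (\<Gamma> c E (tmap c v) y z)"
proof -
  note F' = frameD[OF F]
  have q: "fst v \<in> cdom c" using F' v by blast
  let ?p = "cmap c (fst v)"
  have "((\<lambda>p. FD (field_coords c Z) p (field_coords c Y p)) has_derivative
      (\<lambda>h. D2 (field_coords c Z) ?p h (field_coords c Y ?p)
        + FD (field_coords c Z) ?p (FD (field_coords c Y) ?p h))) (at ?p)"
    by (rule has_derivative_FD[OF open_image[OF F'(1)] _ vfields_smooth_UNIV[OF Z F'(1)]
          vfield_has_derivative[OF Y F'(1) q]]) (use q in blast)
  then have "((\<lambda>\<zeta>. FD (field_coords c Z) (fst \<zeta>) (field_coords c Y (fst \<zeta>))) has_derivative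
      (\<lambda>h. D2 (field_coords c Z) ?p (fst h) y
        + FD (field_coords c Z) ?p (FD (field_coords c Y) ?p (fst h)))) (at (tmap c v))"
    by (intro has_derivative_compose[OF has_derivative_fst[OF has_derivative_ident],
          where g = "\<lambda>p. FD (field_coords c Z) p (field_coords c Y p)"])
      (simp add: tmap_def cinv_cmap[OF F'(1) q] xyz)
  note G = has_derivative_add[OF this christoffel_fields_has_derivative[OF F v Y Z], folded xyz]
  have YG: "coords (D v' Y Z) c = FD (field_coords c Z) (fst (tmap c v')) (field_coords c Y (fst (tmap c v')))
      + \<Gamma> c E (tmap c v') (field_coords c Y (fst (tmap c v'))) (field_coords c Z (fst (tmap c v')))"
    if "v' \<in> A" "fst v' \<in> U" for v'
  proof -
    have "fst v' \<in> cdom c" using that F' by blast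
    then show ?thesis using conn_coords[OF F that Y Z] by (simp add: tmap_def cinv_cmap[OF F'(1)])
  qed
  note * = conn_aniso_coords[OF F v X conn_aniso_field[OF Y Z] G YG xyz(1)]
  show "conn_aniso \<A> A D v X (\<lambda>v'. D v' Y Z) \<in> T (fst v)" by (rule *(1))
  show "coords (conn_aniso \<A> A D v X (\<lambda>v'. D v' Y Z)) c =
      D2 (field_coords c Z) ?p x y
      + FD (field_coords c Z) ?p (FD (field_coords c Y) ?p x)
      + \<Gamma> c E (tmap c v) (FD (field_coords c Y) ?p x) z
      + \<Gamma> c E (tmap c v) y (FD (field_coords c Z) ?p x)
      + \<Gamma> c E (tmap c v) x (FD (field_coords c Z) ?p y)
      + \<delta> c E v (\<lambda>\<zeta>. \<Gamma> c E \<zeta> y z) x + \<Gamma> c E (tmap c v) x (\<Gamma> c E (tmap c v) y z)"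
    by (rule trans[OF *(2)], assumption, assumption,
        simp add: conn_coords[OF F v Y Z] xyz[symmetric] linear_add[OF linear_christoffel_right])
qed

text \<open>When \<open>X\<close> and \<open>Y\<close> are exchanged and the results subtracted, the
  second derivatives of \<open>Z\<close> cancel by symmetry, and the two terms pairing one field
  with the derivative of \<open>Z\<close> along the other are interchanged. The terms with
  derivatives of \<open>X\<close> and \<open>Y\<close> are those of the bracket term. Only values at
  the point remain.\<close>

lemma curvature_coords:
  assumes F: "frame c E U" and v: "v \<in> A" "fst v \<in> U"
    and xyz: "x \<in> T (fst v)" "y \<in> T (fst v)" "z \<in> T (fst v)"
  shows "curvature \<A> A D v x y z \<in> T (fst v)"
    and "coords (curvature \<A> A D v x y z) c =
      \<delta> c E v (\<lambda>\<zeta>. \<Gamma> c E \<zeta> (coords y c) (coords z c)) (coords x c)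
      + \<Gamma> c E (tmap c v) (coords x c) (\<Gamma> c E (tmap c v) (coords y c) (coords z c))
      - \<delta> c E v (\<lambda>\<zeta>. \<Gamma> c E \<zeta> (coords x c) (coords z c)) (coords y c)
      - \<Gamma> c E (tmap c v) (coords y c) (\<Gamma> c E (tmap c v) (coords x c) (coords z c))" (is "_ = ?k")
proof -
  note F' = frameD[OF F]
  have q: "fst v \<in> cdom c" using F' v by blast
  have "conn_aniso \<A> A D v X (\<lambda>v'. D v' Y Z) - conn_aniso \<A> A D v Y (\<lambda>v'. D v' X Z)
      - D v (lie_bracket \<A> X Y) Z \<in> T (fst v) \<and>
    coords (conn_aniso \<A> A D v X (\<lambda>v'. D v' Y Z) - conn_aniso \<A> A D v Y (\<lambda>v'. D v' X Z)
      - D v (lie_bracket \<A> X Y) Z) c = ?k"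
    if X: "X \<in> vfields \<A>" and Y: "Y \<in> vfields \<A>" and Z: "Z \<in> vfields \<A>"
      and e: "X (fst v) = x" "Y (fst v) = y" "Z (fst v) = z" for X Y Z
  proof
    note 1 = conn_aniso_conn_coords[OF F v X Y Z refl refl refl, unfolded e]
    note 2 = conn_aniso_conn_coords[OF F v Y X Z refl refl refl, unfolded e]
    note L = lie_bracket_vfields[OF X Y]
    show "conn_aniso \<A> A D v X (\<lambda>v'. D v' Y Z) - conn_aniso \<A> A D v Y (\<lambda>v'. D v' X Z)
      - D v (lie_bracket \<A> X Y) Z \<in> T (fst v)"
      by (intro subspace_diff subspace_tangent 1(1) 2(1) conn_tangent v L Z)
    have s: "D2 (field_coords c Z) (cmap c (fst v)) (coords x c) (coords y c)
        = D2 (field_coords c Z) (cmap c (fst v)) (coords y c) (coords x c)"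
      by (rule D2_symmetric[OF open_image[OF F'(1)] _ vfields_smooth_UNIV[OF Z F'(1)]]) (use q in blast)
    have l: "linear (FD (field_coords c Z) (cmap c (fst v)))"
      using has_derivative_linear[OF vfield_has_derivative[OF Z F'(1) q]] .
    show "coords (conn_aniso \<A> A D v X (\<lambda>v'. D v' Y Z) - conn_aniso \<A> A D v Y (\<lambda>v'. D v' X Z)
      - D v (lie_bracket \<A> X Y) Z) c = ?k"
      by (simp add: 1(2) 2(2) conn_coords[OF F v L Z] coords_lie_bracket[OF F'(1) q] e s
          linear_diff[OF l] linear_diff[OF linear_christoffel_left])
  qed
  note * = on_vectors3_coords[OF F'(1) q xyz this]
  show "curvature \<A> A D v x y z \<in> T (fst v)" unfolding curvature_def by (rule *(1))
  show "coords (curvature \<A> A D v x y z) c = ?k" unfolding curvature_def by (rule *(2))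
qed

section \<open>The difference tensor and the comparison of the two curvatures\<close>

context
  fixes D' :: "('a, 'e) conn"
  assumes D': "aniso_connection \<A> A D'"
begin

interpretation D': aniso_conn \<A> A D' by unfold_locales (rule D')

abbreviation q :: "('a, 'e) chart \<Rightarrow> ('e \<Rightarrow> 'a \<Rightarrow> ('a, 'e) tvec) \<Rightarrow> 'e \<times> 'e \<Rightarrow> 'e \<Rightarrow> 'e \<Rightarrow> 'e" where
  "q c E \<zeta> a b \<equiv> christoffel D' c E \<zeta> a b - \<Gamma> c E \<zeta> a b"

abbreviation Q :: "('a, 'e) tensor2" where "Q \<equiv> difference_tensor \<A> D' D"

lemma q_has_derivative:
  assumes F: "frame c E U" and v: "v \<in> A" "fst v \<in> U"
  shows "((\<lambda>\<zeta>. q c E \<zeta> a b) has_derivative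
    (\<lambda>h. FD (\<lambda>\<zeta>. christoffel D' c E \<zeta> a b) (tmap c v) h - FD (\<lambda>\<zeta>. \<Gamma> c E \<zeta> a b) (tmap c v) h)) (at (tmap c v))"
  by (intro has_derivative_diff FD_works christoffel_differentiable[OF F v] D'.christoffel_differentiable[OF F v])

text \<open>Both connections differentiate \<open>Y\<close> by the same term, so in a common frame
  only the difference of the Christoffel symbols is left.\<close>

lemma difference_tensor_coords:
  assumes F: "frame c E U" and v: "v \<in> A" "fst v \<in> U" and xy: "x \<in> T (fst v)" "y \<in> T (fst v)"
  shows "Q v x y \<in> T (fst v)" and "coords (Q v x y) c = q c E (tmap c v) (coords x c) (coords y c)"
proof -
  note F' = frameD[OF F]
  have q: "fst v \<in> cdom c" using F' v by blast
  have "D' v X Y - D v X Y \<in> T (fst v) \<and>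
    coords (D' v X Y - D v X Y) c = q c E (tmap c v) (coords x c) (coords y c)"
    if X: "X \<in> vfields \<A>" and Y: "Y \<in> vfields \<A>" and e: "X (fst v) = x" "Y (fst v) = y" for X Y
  proof
    show "D' v X Y - D v X Y \<in> T (fst v)"
      by (intro subspace_diff subspace_tangent conn_tangent D'.conn_tangent v X Y)
  qed (simp add: conn_coords[OF F v X Y] D'.conn_coords[OF F v X Y] e)
  note * = on_vectors2_coords[OF F'(1) q xy this]
  show "Q v x y \<in> T (fst v)" unfolding difference_tensor_def by (rule *(1))
  show "coords (Q v x y) c = q c E (tmap c v) (coords x c) (coords y c)"
    unfolding difference_tensor_def by (rule *(2))
qed

lemma difference_tensor_tangent:
  assumes "v \<in> A" "x \<in> T (fst v)" "y \<in> T (fst v)"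
  shows "Q v x y \<in> T (fst v)"
  using frame_exists[of "fst v"] difference_tensor_coords(1) assms by metis

lemma difference_tensor_fields:
  assumes v: "v \<in> A" and X: "X \<in> vfields \<A>" and Y: "Y \<in> vfields \<A>"
  shows "Q v (X (fst v)) (Y (fst v)) = D' v X Y - D v X Y"
proof -
  obtain c E U where F: "frame c E U" "fst v \<in> U" by (rule frame_exists)
  note F' = frameD[OF F(1)]
  note t = vfields_tangent[OF X UNIV_I, of "fst v"] vfields_tangent[OF Y UNIV_I, of "fst v"]
  show ?thesis
  proof (rule tangent_eqI[OF difference_tensor_tangent[OF v t] _ F'(1)])
    show "D' v X Y - D v X Y \<in> T (fst v)"
      by (intro subspace_diff subspace_tangent conn_tangent D'.conn_tangent v X Y)
  qed (use F F' in \<open>auto simp: difference_tensor_coords(2)[OF F(1) v F(2) t]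
      conn_coords[OF F(1) v F(2) X Y] D'.conn_coords[OF F(1) v F(2) X Y]\<close>)
qed

text \<open>Required before \<open>conn_aniso_coords\<close> can be applied to \<open>Q\<close>.
  \<open>Q\<close> is given pointwise by a description; its smoothness comes from rewriting it as
  the difference of the connections on the two fields.\<close>

lemma difference_tensor_aniso:
  assumes X: "X \<in> vfields \<A>" and Y: "Y \<in> vfields \<A>"
  shows "(\<lambda>v. Q v (X (fst v)) (Y (fst v))) \<in> aniso_fields \<A> A"
  unfolding aniso_fields_def
proof safe
  show "Q (p, w) (X (fst (p, w))) (Y (fst (p, w))) \<in> T (fst (p, w))" if "(p, w) \<in> A" for p w
    by (intro difference_tensor_tangent that) (simp_all add: vfields_tangent[OF X] vfields_tangent[OF Y])
  fix c assume c: "c \<in> \<A>"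
  have o: "open (over c (cdom c))" using open_over[OF c open_cdom[OF c]] by simp
  have "smooth_on (over c (cdom c)) (\<lambda>\<zeta>. aniso_coords c (\<lambda>v. D' v X Y) \<zeta> - aniso_coords c (\<lambda>v. D v X Y) \<zeta>)"
    by (intro smooth_on_diff o aniso_fields_smooth conn_aniso_field D'.conn_aniso_field X Y c)
  then have "smooth_on (over c (cdom c)) (aniso_coords c (\<lambda>v. Q v (X (fst v)) (Y (fst v))))"
    by (rule smooth_on_cong[OF o, rotated])
      (use c in \<open>auto simp: over_def tinv_tmap difference_tensor_fields[OF _ X Y, unfolded fst_conv]\<close>,
        metis c tinv_tmap difference_tensor_fields[OF _ X Y] fst_conv coords_diff)
  then show "smooth_on (tmap c ` (A \<inter> tdom \<A> c)) (aniso_coords c (\<lambda>v. Q v (X (fst v)) (Y (fst v))))"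
    by (simp add: over_cdom c)
qed

lemma difference_tensor_vertical_deriv_coords:
  assumes F: "frame c E U" and v: "v \<in> A" "fst v \<in> U"
    and xyz: "x \<in> T (fst v)" "y \<in> T (fst v)" "z \<in> T (fst v)"
  shows "vertical_deriv (\<lambda>v'. Q v' x y) v z \<in> T (fst v)"
    and "coords (vertical_deriv (\<lambda>v'. Q v' x y) v z) c
      = FD (\<lambda>\<zeta>. q c E \<zeta> (coords x c) (coords y c)) (tmap c v) (0, coords z c)"
proof -
  note F' = frameD[OF F]
  have qc: "fst v \<in> cdom c" using F' v by blast
  have G: "((\<lambda>\<zeta>. q c E \<zeta> (coords x c) (coords y c)) has_derivative
      FD (\<lambda>\<zeta>. q c E \<zeta> (coords x c) (coords y c)) (tmap c v)) (at (tmap c v))"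
    by (intro FD_works differentiableI[OF q_has_derivative[OF F v]])
  have t: "Q v' x y \<in> T (fst v)" if "v' \<in> A" "fst v' = fst v" for v'
    using difference_tensor_tangent[OF that(1), unfolded that(2), OF xyz(1,2)] .
  have c: "coords (Q v' x y) c = q c E (tmap c v') (coords x c) (coords y c)" if "v' \<in> A" "fst v' = fst v" for v'
    using difference_tensor_coords(2)[OF F that(1), unfolded that(2), OF v(2) xyz(1,2)] .
  note * = vertical_deriv_coords[OF v(1) xyz(3) F'(1) qc t G c]
  show "vertical_deriv (\<lambda>v'. Q v' x y) v z \<in> T (fst v)" by (rule *(1))
  show "coords (vertical_deriv (\<lambda>v'. Q v' x y) v z) c
      = FD (\<lambda>\<zeta>. q c E \<zeta> (coords x c) (coords y c)) (tmap c v) (0, coords z c)" by (rule *(2))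
qed

text \<open>The product rule produces \<open>q\<close> at derivatives of \<open>Y\<close> and of
  \<open>Z\<close>. The two correction terms of the covariant derivative contain the same
  expressions and remove them, which gives tensoriality.\<close>

lemma cov_deriv_difference_tensor_coords:
  assumes F: "frame c E U" and v: "v \<in> A" "fst v \<in> U"
    and xyz: "x \<in> T (fst v)" "y \<in> T (fst v)" "z \<in> T (fst v)"
  shows "cov_deriv \<A> A D Q v x y z \<in> T (fst v)"
    and "coords (cov_deriv \<A> A D Q v x y z) c =
      \<delta> c E v (\<lambda>\<zeta>. q c E \<zeta> (coords y c) (coords z c)) (coords x c)
      + \<Gamma> c E (tmap c v) (coords x c) (q c E (tmap c v) (coords y c) (coords z c))
      - q c E (tmap c v) (\<Gamma> c E (tmap c v) (coords x c) (coords y c)) (coords z c)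
      - q c E (tmap c v) (coords y c) (\<Gamma> c E (tmap c v) (coords x c) (coords z c))" (is "_ = ?k")
proof -
  note F' = frameD[OF F]
  have qc: "fst v \<in> cdom c" using F' v by blast
  let ?\<xi> = "tmap c v" and ?p = "cmap c (fst v)"
  have "cov_deriv_aniso \<A> A D Q v X (\<lambda>v'. Y (fst v')) (\<lambda>v'. Z (fst v')) \<in> T (fst v) \<and>
    coords (cov_deriv_aniso \<A> A D Q v X (\<lambda>v'. Y (fst v')) (\<lambda>v'. Z (fst v'))) c = ?k"
    if X: "X \<in> vfields \<A>" and Y: "Y \<in> vfields \<A>" and Z: "Z \<in> vfields \<A>"
      and e: "X (fst v) = x" "Y (fst v) = y" "Z (fst v) = z" for X Y Z
  proof -
    note cY = conn_aniso_vfield_coords[OF F v X Y, unfolded e]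
    note cZ = conn_aniso_vfield_coords[OF F v X Z, unfolded e]
    note G = has_derivative_diff[OF D'.christoffel_fields_has_derivative[OF F v Y Z]
        christoffel_fields_has_derivative[OF F v Y Z], unfolded e]
    have YG: "coords (Q v' (Y (fst v')) (Z (fst v'))) c
        = q c E (tmap c v') (field_coords c Y (fst (tmap c v'))) (field_coords c Z (fst (tmap c v')))"
      if "v' \<in> A" "fst v' \<in> U" for v'
    proof -
      have "fst v' \<in> cdom c" using that F' by blast
      then show ?thesis
        using difference_tensor_coords(2)[OF F that vfields_tangent[OF Y] vfields_tangent[OF Z]]
        by (simp add: tmap_def cinv_cmap[OF F'(1)])
    qed
    note cQ = conn_aniso_coords[OF F v X difference_tensor_aniso[OF Y Z] G YG, OF _ _ refl, unfolded e]
    note Q1 = difference_tensor_coords[OF F v cY(1) xyz(3)]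
    note Q2 = difference_tensor_coords[OF F v xyz(2) cZ(1)]
    have k: "\<delta> c E v (\<lambda>\<zeta>. q c E \<zeta> (coords y c) (coords z c)) (coords x c)
      = \<delta> c E v (\<lambda>\<zeta>. christoffel D' c E \<zeta> (coords y c) (coords z c)) (coords x c)
        - \<delta> c E v (\<lambda>\<zeta>. \<Gamma> c E \<zeta> (coords y c) (coords z c)) (coords x c)"
      unfolding FD_eq[OF q_has_derivative[OF F v]] ..
    show ?thesis
    proof
      show "cov_deriv_aniso \<A> A D Q v X (\<lambda>v'. Y (fst v')) (\<lambda>v'. Z (fst v')) \<in> T (fst v)"
        unfolding cov_deriv_aniso_def e by (intro subspace_diff subspace_tangent cQ(1) Q1(1) Q2(1))
      show "coords (cov_deriv_aniso \<A> A D Q v X (\<lambda>v'. Y (fst v')) (\<lambda>v'. Z (fst v'))) c = ?k"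
        unfolding cov_deriv_aniso_def k e
        by (simp add: cQ(2) Q1(2) Q2(2) cY(2) cZ(2) difference_tensor_coords(2)[OF F v xyz(2,3)]
            linear_add[OF linear_christoffel_left] linear_add[OF linear_christoffel_right])
    qed
  qed
  note * = on_vectors3_coords[OF F'(1) qc xyz this]
  show "cov_deriv \<A> A D Q v x y z \<in> T (fst v)" unfolding cov_deriv_def by (rule *(1))
  show "coords (cov_deriv \<A> A D Q v x y z) c = ?k" unfolding cov_deriv_def by (rule *(2))
qed

text \<open>Among the iterated symbols of \<open>D'\<close>, the mixed terms \<Gamma>(u, q(w, z))
  and q(u, \<Gamma>(w, z)) match connection terms in the covariant derivatives of \<open>Q\<close>,
  the first for \<open>u\<close> and the second, with its sign reversed, for \<open>w\<close>. The
  terms quadratic in \<open>q\<close> are the last two of the formula.\<close>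

lemma curvature_difference:
  assumes v: "v \<in> A" and uwz: "u \<in> T (fst v)" "w \<in> T (fst v)" "z \<in> T (fst v)"
  shows "curvature \<A> A D' v u w z = curvature \<A> A D v u w z
    - conn_vertical_deriv \<A> D v w z (Q v u (snd v)) + conn_vertical_deriv \<A> D v u z (Q v w (snd v))
    + (cov_deriv \<A> A D Q v u w z - cov_deriv \<A> A D Q v w u z + Q v (torsion \<A> D v u w) z
       + vertical_deriv (\<lambda>v'. Q v' u z) v (Q v w (snd v)) - vertical_deriv (\<lambda>v'. Q v' w z) v (Q v u (snd v))
       + Q v u (Q v w z) - Q v w (Q v u z))"
proof -
  obtain c E U where F: "frame c E U" and U: "fst v \<in> U" by (rule frame_exists)
  note F' = frameD[OF F]
  have qc: "fst v \<in> cdom c" using F' U by blast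
  note t = A_tangent[OF v] uwz
  note Q = difference_tensor_coords[OF F v U]
  note dQ = difference_tensor_vertical_deriv_coords[OF F v U]
  note P = conn_vertical_deriv_coords[OF F v U]
  note \<T> = torsion_coords[OF F v U]
  note R = curvature_coords[OF F v U] D'.curvature_coords[OF F v U]
  note C = cov_deriv_difference_tensor_coords[OF F v U]
  \<comment> \<open>Horizontal arguments are split into base and vertical parts, and the vertical
    argument given by \<open>Q\<close> into the two Christoffel symbols, so that both sides become
    combinations of the same derivatives.\<close>
  have split: "FD (\<lambda>\<zeta>. christoffel C c E \<zeta> a b) (tmap c v) (x, - y)
      = FD (\<lambda>\<zeta>. christoffel C c E \<zeta> a b) (tmap c v) (x, 0) - FD (\<lambda>\<zeta>. christoffel C c E \<zeta> a b) (tmap c v) (0, y)"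
    and vert: "FD (\<lambda>\<zeta>. christoffel C c E \<zeta> a b) (tmap c v) (0, x - y)
      = FD (\<lambda>\<zeta>. christoffel C c E \<zeta> a b) (tmap c v) (0, x) - FD (\<lambda>\<zeta>. christoffel C c E \<zeta> a b) (tmap c v) (0, y)"
    if "aniso_conn \<A> A C" for C a b x y
  proof -
    have l: "linear (FD (\<lambda>\<zeta>. christoffel C c E \<zeta> a b) (tmap c v))"
      by (intro FD_linear aniso_conn.christoffel_differentiable[OF that F v U])
    show "FD (\<lambda>\<zeta>. christoffel C c E \<zeta> a b) (tmap c v) (x, - y)
      = FD (\<lambda>\<zeta>. christoffel C c E \<zeta> a b) (tmap c v) (x, 0) - FD (\<lambda>\<zeta>. christoffel C c E \<zeta> a b) (tmap c v) (0, y)"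
      using linear_diff[OF l, of "(x, 0)" "(0, y)"] by simp
    show "FD (\<lambda>\<zeta>. christoffel C c E \<zeta> a b) (tmap c v) (0, x - y)
      = FD (\<lambda>\<zeta>. christoffel C c E \<zeta> a b) (tmap c v) (0, x) - FD (\<lambda>\<zeta>. christoffel C c E \<zeta> a b) (tmap c v) (0, y)"
      using linear_diff[OF l, of "(0, x)" "(0, y)"] by simp
  qed
  show ?thesis
  proof (rule tangent_eqI[OF _ _ F'(1) qc])
    show "curvature \<A> A D' v u w z \<in> T (fst v)" by (intro R t)
  next
    show "curvature \<A> A D v u w z
      - conn_vertical_deriv \<A> D v w z (Q v u (snd v)) + conn_vertical_deriv \<A> D v u z (Q v w (snd v))
      + (cov_deriv \<A> A D Q v u w z - cov_deriv \<A> A D Q v w u z + Q v (torsion \<A> D v u w) z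
       + vertical_deriv (\<lambda>v'. Q v' u z) v (Q v w (snd v)) - vertical_deriv (\<lambda>v'. Q v' w z) v (Q v u (snd v))
       + Q v u (Q v w z) - Q v w (Q v u z)) \<in> T (fst v)"
      by (intro subspace_add subspace_diff subspace_tangent R(1) P(1) C(1) Q(1) dQ(1) \<T>(1) t)
  next
    show "coords (curvature \<A> A D' v u w z) c = coords (curvature \<A> A D v u w z
      - conn_vertical_deriv \<A> D v w z (Q v u (snd v)) + conn_vertical_deriv \<A> D v u z (Q v w (snd v))
      + (cov_deriv \<A> A D Q v u w z - cov_deriv \<A> A D Q v w u z + Q v (torsion \<A> D v u w) z
       + vertical_deriv (\<lambda>v'. Q v' u z) v (Q v w (snd v)) - vertical_deriv (\<lambda>v'. Q v' w z) v (Q v u (snd v))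
       + Q v u (Q v w z) - Q v w (Q v u z))) c"
      by (simp add: R(2,4) P(2) C(2) Q dQ(2) \<T> t FD_eq[OF q_has_derivative[OF F v U]]
          split[OF aniso_conn_axioms] split[OF D'.aniso_conn_axioms]
          vert[OF aniso_conn_axioms] vert[OF D'.aniso_conn_axioms]
          linear_diff[OF linear_christoffel_left] linear_diff[OF linear_christoffel_right])
  qed
qed

end

end

theorem proposition2p16:
  fixes \<A> :: "('a::{t2_space,second_countable_topology}, 'e::euclidean_space) chart set"
    and A :: "('a, 'e) tpoint set"
    and D' D :: "('a, 'e) conn"
    and R' R P Q' dQ :: "('a, 'e) tensor3"
    and Q \<T> :: "('a, 'e) tensor2"
  assumes manifold: "smooth_atlas \<A>"
    and A_open: "open_in_tangent_bundle \<A> A"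
    and A_onto: "fst ` A = UNIV"
    and D': "aniso_connection \<A> A D'"
    and D: "aniso_connection \<A> A D"
    and R': "R' = curvature \<A> A D'"
    and R: "R = curvature \<A> A D"
    and Q: "Q = difference_tensor \<A> D' D"
    and P: "P = conn_vertical_deriv \<A> D"
    and \<T>: "\<T> = torsion \<A> D"
    and dQ: "dQ = (\<lambda>v x y z. vertical_deriv (\<lambda>v'. Q v' x y) v z)"
    and Q': "Q' = (\<lambda>v u w z.
          cov_deriv \<A> A D Q v u w z - cov_deriv \<A> A D Q v w u z + Q v (\<T> v u w) z
          + dQ v u z (Q v w (snd v)) - dQ v w z (Q v u (snd v))
          + Q v u (Q v w z) - Q v w (Q v u z))"
    and v: "v \<in> A"
    and uwz: "u \<in> tangent_space \<A> (fst v)" "w \<in> tangent_space \<A> (fst v)"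
             "z \<in> tangent_space \<A> (fst v)"
  shows "R' v u w z =
           R v u w z - P v w z (Q v u (snd v)) + P v u z (Q v w (snd v)) + Q' v u w z"
proof -
  interpret aniso_conn \<A> A D
    using manifold A_open D by unfold_locales
  show ?thesis
    unfolding R' R P Q' dQ \<T> Q by (rule curvature_difference[OF D' v uwz])
qed

end
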